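(* Let $\nu\ge2$ be an integer. For every $g\ge0$ and $s$ near $0$, the functions $e_g$ satisfy $$\frac{\partial^2}{\partial w^2}\left[w^{2-2g}e_g\left(-w^{\nu-1}s\right)\right]\Big|_{w=1}=-\sum_{n=1}^{g}\frac{2}{(2n+2)!}\frac{\partial^{2n+2}}{\partial w^{2n+2}}\left[w^{2-2(g-n)}e_{g-n}(-w^{\nu-1}s)\right]\Big|_{w=1}+\left(\text{the }k^{-2g}\text{ term of }\log\Bigl(\sum_{n=0}^\infty\frac1{k^{2n}}z_n(s)\Bigr)\right),$$ where the last term is the coefficient of $k^{-2g}$ in the formal series in $k^{-2}$.
   Context: For $t\ge0$ let $$Z_k(t)=\int_{\mathbb R^k}\exp\Bigl(-k\sum_{j=1}^k\bigl(\tfrac12\lambda_j^2+t\lambda_j^{2\nu}\bigr)\Bigr)\prod_{j\ne\ell}|\lambda_j-\lambda_\ell|\,d^k\lambda .$$ As $k\to\infty$ one has the asymptotic expansion $\log\bigl(Z_k(t)/Z_k(0)\bigr)=\sum_{g\ge0}k^{2-2g}e_g(t)$ (truncation after $k^{-2h}$ gives an error $O(k^{-2h-2})$); the coefficients $e_g(t)$, $t=t_{2\nu}$, are analytic in a neighborhood of $t=0$. For $\xi\le0$, $b_k(\xi)>0$ are the recurrence coefficients $\lambda p_n=b_{n+1}p_{n+1}+b_np_{n-1}$ of the orthonormal polynomials for the weight $\exp(-\tfrac12\lambda^2+2\xi\lambda^{2\nu})d\lambda$ on $\mathbb R$ (so $b_k(0)^2=k$). With $s=2k^{\nu-1}\xi\le0$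 fixed, as $k\to\infty$, $b_k^2\simeq k\sum_{g\ge0}z_g(s)k^{-2g}$, where the $z_g$ are analytic near $s=0$, $z_0(0)=1$, $z_g(0)=0$ for $g\ge1$. *)

theory Defs
  imports "HOL-Complex_Analysis.Complex_Analysis"
begin

text \<open>The product ranges over ordered pairs, so every unordered pair contributes
  \<open>\<bar>l i - l j\<bar>\<^sup>2\<close>.\<close>

definition partition_function :: "nat \<Rightarrow> nat \<Rightarrow> real \<Rightarrow> real" where
  "partition_function \<nu> k t =
     (\<integral>l. exp (- real k * (\<Sum>j=1..k. (1/2) * (l j)^2 + t * (l j)^(2*\<nu>)))
          * (\<Prod>(i,j) \<in> {(i,j). i \<in> {1..k} \<and> j \<in> {1..k} \<and> i \<noteq> j}. \<bar>l i - l j\<bar>)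
        \<partial>(Pi\<^sub>M {1..k} (\<lambda>_. lborel)))"

definition even_weight :: "nat \<Rightarrow> real \<Rightarrow> real \<Rightarrow> real" where
  "even_weight \<nu> \<xi> x = exp (- (1/2) * x^2 + 2 * \<xi> * x^(2*\<nu>))"

definition orthonormal_polys :: "(real \<Rightarrow> real) \<Rightarrow> (nat \<Rightarrow> real poly) \<Rightarrow> bool" where
  "orthonormal_polys W p \<longleftrightarrow>
     (\<forall>n. degree (p n) = n \<and> lead_coeff (p n) > 0) \<and>
     (\<forall>m n. has_bochner_integral lborel (\<lambda>x. poly (p m) x * poly (p n) x * W x)
               (if m = n then 1 else 0))"

text \<open>The recurrence at \<open>n = 0\<close> uses the convention \<open>p\<^bsub>-1\<^esub> = 0\<close>; the value
  \<open>\<beta> 0\<close> is irrelevant.\<close>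

definition recurrence_coeffs :: "(real \<Rightarrow> real) \<Rightarrow> (nat \<Rightarrow> real) \<Rightarrow> bool" where
  "recurrence_coeffs W \<beta> \<longleftrightarrow>
     (\<forall>n\<ge>1. \<beta> n > 0) \<and>
     (\<exists>p. orthonormal_polys W p \<and>
          [:0, 1:] * p 0 = smult (\<beta> 1) (p 1) \<and>
          (\<forall>n\<ge>1. [:0, 1:] * p n = smult (\<beta> (n + 1)) (p (n + 1)) + smult (\<beta> n) (p (n - 1))))"

text \<open>\<open>f k \<simeq> \<Sum>g. c g * k powi (a - 2 * g)\<close> as \<open>k\<close> tends to infinity: the error of every truncation
  has the order of the first omitted term.\<close>

definition has_asymp_expansion :: "(nat \<Rightarrow> complex) \<Rightarrow> int \<Rightarrow> (nat \<Rightarrow> complex) \<Rightarrow> bool" where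
  "has_asymp_expansion f a c \<longleftrightarrow>
     (\<forall>m. (\<lambda>k. f k - (\<Sum>g\<le>m. c g * of_nat k powi (a - 2 * int g)))
           \<in> O(\<lambda>k. of_nat k powi (a - 2 * int (m + 1))))"

text \<open>Writing \<open>F = a * (1 + G)\<close> with \<open>a = F $ 0 \<noteq> 0\<close> and \<open>G $ 0 = 0\<close>, this is
  \<open>log F = Ln a + log (1 + G)\<close>; note that \<open>fps_ln 1\<close> is the series of \<open>log (1 + X)\<close>.\<close>

definition fps_log :: "complex fps \<Rightarrow> complex fps" where
  "fps_log F = fps_const (Ln (F $ 0)) + (fps_ln 1 oo (fps_const (1 / F $ 0) * F - 1))"

end

theory Submission
  imports Defs "Jordan_Normal_Form.Determinant" "HOL-Real_Asymp.Real_Asymp"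
begin

text \<open>
  By Heine's formula the partition function is a product of squared norms of orthogonal
  polynomials, so after rescaling the second difference of \<open>log (Z\<^sub>k / Z\<^sub>k(0))\<close> in \<open>k\<close>, at fixed
  \<open>\<xi>\<close>, equals \<open>log (b\<^sub>k(\<xi>)\<^sup>2 / b\<^sub>k(0)\<^sup>2)\<close>, and \<open>b\<^sub>k(0)\<^sup>2 = k\<close>. Fixing \<open>\<xi>\<close> means evaluating \<open>Z\<^bsub>k\<plusminus>1\<^esub>\<close>
  at times that move with \<open>k\<close>, where the expansion, known only for each fixed time, does
  not apply directly. By Baire's theorem, however, a pointwise big-O bound on continuous functions is
  uniform on some subinterval of every interval. For \<open>-s\<close> in such an interval the expansion can
  be inserted, and comparing powers of \<open>1/k\<close> gives the identity; since both sides are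
  holomorphic in \<open>s\<close>, it extends to a neighbourhood of \<open>0\<close>.
\<close>

hide_const (open) Determinants.det module.smult
no_notation vec_index (infixl "$" 100)

section \<open>Orthogonal polynomial ensembles\<close>

text \<open>Passing to the variables sqrt k * \<open>l j\<close> turns the k-particle weight at time
  t into \<open>even_weight \<nu> \<xi>\<close> with t = - 2 \<xi> k^(\<nu>-1). For \<xi> = s / (2
  k^(\<nu>-1)), the j-particle ensemble with this weight thus sits at time - w^(\<nu>-1) s, where w
  = j/k, and k^(-2) times its expansion has the terms k^(-2h) w^(2-2h) e_h(- w^(\<nu>-1) s). This is
  where the functions differentiated in the theorem come from: the second difference in k is a
  second difference in w at 1 with step 1/k. Its Taylor series keeps only even derivatives, with
  weights 2/(2n+2)!; the term n = 0 has weight 2/2! = 1 and is the left-hand side.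

  The expansions are given for real s <= 0, the claim concerns complex s around 0. The identity
  theorem needs only one real segment inside the disc of holomorphy, so it does no harm that Baire's
  theorem leaves the position of the segment open.\<close>

lemma poly_eqI_roots:
  fixes p q :: "'a::idom poly"
  assumes "finite A" "\<And>x. x \<in> A \<Longrightarrow> poly p x = poly q x"
    and "degree p \<le> card A" "degree q \<le> card A" "coeff p (card A) = coeff q (card A)"
  shows "p = q"
proof (rule ccontr)
  assume ne: "p \<noteq> q"
  have "degree (p - q) \<le> card A" using assms by (simp add: degree_diff_le)
  moreover have "degree (p - q) \<noteq> card A"
  proof
    assume "degree (p - q) = card A"
    hence "lead_coeff (p - q) = 0" using assms(5) by (metis coeff_diff right_minus_eq)
    thus False using ne by (simp only: leading_coeff_0_iff) simp
  qed
  ultimately have "degree (p - q) < card A" by simp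
  moreover have "A \<subseteq> {x. poly (p - q) x = 0}" using assms by auto
  hence "card A \<le> card {x. poly (p - q) x = 0}"
    using ne by (intro card_mono poly_roots_finite) auto
  moreover have "\<dots> \<le> degree (p - q)" using ne by (intro card_poly_roots_bound) auto
  ultimately show False by simp
qed

lemma degree_prod_linear:
  fixes x :: "nat \<Rightarrow> 'a::idom"
  shows "degree (\<Prod>i<n. [:- x i, 1:]) = n \<and> coeff (\<Prod>i<n. [:- x i, 1:]) n = 1"
proof -
  have "degree (\<Prod>i<n. [:- x i, 1:]) = (\<Sum>i<n. degree [:- x i, 1:])"
    by (rule degree_prod_eq_sum_degree) auto
  hence deg: "degree (\<Prod>i<n. [:- x i, 1:]) = n" by simp
  moreover have "lead_coeff (\<Prod>i<n. [:- x i, 1:]) = 1" by (simp only: lead_coeff_prod) simp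
  ultimately show ?thesis unfolding deg using deg by blast
qed

text \<open>With the last node replaced by a free variable y, the determinant is a polynomial in y
  of degree at most n that vanishes at the other nodes, so its top coefficient determines it.
  Arbitrary \<open>q j\<close> of degree j stand in for monomials so that orthonormal polynomials
  can be inserted directly.\<close>

lemma det_polys_eq_vandermonde:
  fixes x :: "nat \<Rightarrow> 'a::idom" and q :: "nat \<Rightarrow> 'a poly"
  assumes deg: "\<And>j. degree (q j) = j"
  shows "det (mat n n (\<lambda>(i,j). poly (q j) (x i))) =
    (\<Prod>j<n. lead_coeff (q j)) * (\<Prod>i<n. \<Prod>j<i. x i - x j)"
proof (induction n)
  case 0
  show ?case by (simp add: det_def')
next
  case (Suc n)
  define A where "A y = mat (Suc n) (Suc n) (\<lambda>(i,j). poly (q j) (if i = n then y else x i))" for y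
  define c where "c j = cofactor (A 0) n j" for j
  have A: "A y \<in> carrier_mat (Suc n) (Suc n)" for y by (simp add: A_def)
  have cof: "cofactor (A y) n j = c j" for y j
  proof -
    have "mat_delete (A y) n j = mat_delete (A 0) n j"
      unfolding mat_delete_def by (rule eq_matI) (auto simp: A_def)
    thus ?thesis by (simp add: c_def cofactor_def)
  qed
  have cn: "c n = det (mat n n (\<lambda>(i,j). poly (q j) (x i)))"
  proof -
    have "mat_delete (A 0) n n = mat n n (\<lambda>(i,j). poly (q j) (x i))"
      unfolding mat_delete_def by (rule eq_matI) (auto simp: A_def)
    thus ?thesis by (simp add: c_def cofactor_def)
  qed
  define R where "R = (\<Sum>j<Suc n. smult (c j) (q j))"
  have R: "det (A y) = poly R y" for y
    unfolding laplace_expansion_row[OF A, of n y, simplified] cof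
    by (auto simp: R_def A_def poly_sum mult.commute intro!: sum.cong)
  have degR: "degree R \<le> n" unfolding R_def
    by (rule degree_sum_le) (auto intro: order.trans[OF degree_smult_le] simp: deg)
  have coeffR: "coeff R n = c n * lead_coeff (q n)"
  proof -
    have "coeff R n = (\<Sum>j<Suc n. c j * coeff (q j) n)" by (simp add: R_def coeff_sum)
    also have "\<dots> = c n * coeff (q n) n" using deg by (simp add: coeff_eq_0)
    finally show ?thesis by (simp add: deg)
  qed
  have eqA: "mat (Suc n) (Suc n) (\<lambda>(i,j). poly (q j) (x i)) = A (x n)"
    by (rule eq_matI) (auto simp: A_def)
  have root: "poly R (x i) = 0" if "i < n" for i
    unfolding R[symmetric] using that
    by (intro det_identical_rows[OF A, of i n]) (auto simp: A_def intro!: eq_vecI)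
  have "poly R (x n) = c n * lead_coeff (q n) * (\<Prod>j<n. x n - x j)"
  proof (cases "inj_on x {..<n}")
    case True
    have "R = smult (c n * lead_coeff (q n)) (\<Prod>i<n. [:- x i, 1:])"
    proof (rule poly_eqI_roots[of "x ` {..<n}"])
      show "degree (smult (c n * lead_coeff (q n)) (\<Prod>i<n. [:- x i, 1:])) \<le> card (x ` {..<n})"
        using degree_prod_linear[of x n] True
        by (intro order.trans[OF degree_smult_le]) (simp add: card_image)
      show "coeff R (card (x ` {..<n})) =
          coeff (smult (c n * lead_coeff (q n)) (\<Prod>i<n. [:- x i, 1:])) (card (x ` {..<n}))"
        using degree_prod_linear[of x n] True coeffR by (simp add: card_image)
    qed (use root degR True in \<open>auto simp: card_image poly_prod\<close>)
    thus ?thesis by (simp add: poly_prod)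
  next
    \<comment> \<open>Coinciding nodes give too few roots to identify R, but then both determinants
      have two equal rows and both sides vanish.\<close>
    case False
    then obtain i j where ij: "i < n" "j < n" "i \<noteq> j" "x i = x j" by (auto simp: inj_on_def)
    have "c n = 0" unfolding cn
      by (rule det_identical_rows[of _ n i j]) (use ij in \<open>auto intro!: eq_vecI\<close>)
    moreover have "det (A (x n)) = 0"
      by (rule det_identical_rows[OF A, of i j]) (use ij in \<open>auto simp: A_def intro!: eq_vecI\<close>)
    ultimately show ?thesis by (simp add: R)
  qed
  thus ?case unfolding eqA R by (simp add: cn Suc)
qed

text \<open>The pairs with i > j and their swaps contribute the same factor, and squaring removes
  the absolute values. The shift by \<open>Suc\<close> reconciles variables numbered from 1 with
  matrix rows numbered from 0.\<close>

lemma prod_abs_diff_off_diagonal: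
  fixes l :: "nat \<Rightarrow> real"
  shows "(\<Prod>(i,j) \<in> {(i,j). i \<in> {1..k} \<and> j \<in> {1..k} \<and> i \<noteq> j}. \<bar>l i - l j\<bar>) =
    (\<Prod>i<k. \<Prod>j<i. l (Suc i) - l (Suc j))\<^sup>2"
proof -
  let ?U = "(\<lambda>(i,j). (Suc i, Suc j)) ` (SIGMA i:{..<k}. {..<i})"
  have U: "{(i,j). i \<in> {1..k} \<and> j \<in> {1..k} \<and> i \<noteq> j} = ?U \<union> prod.swap ` ?U"
  proof (intro equalityI subsetI)
    fix z assume z: "z \<in> {(i,j). i \<in> {1..k} \<and> j \<in> {1..k} \<and> i \<noteq> j}"
    then obtain i j where ij: "z = (Suc i, Suc j)" "i < k" "j < k" "i \<noteq> j"
      by (cases z; cases "fst z"; cases "snd z") auto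
    thus "z \<in> ?U \<union> prod.swap ` ?U"
      by (cases "j < i") (force simp: image_iff)+
  qed auto
  have fin: "finite ?U" by auto
  have P: "(\<Prod>(i,j)\<in>?U. \<bar>l i - l j\<bar>) = \<bar>\<Prod>i<k. \<Prod>j<i. l (Suc i) - l (Suc j)\<bar>"
    by (subst prod.reindex) (auto simp: inj_on_def prod.Sigma abs_prod case_prod_unfold)
  have "(\<Prod>(i,j) \<in> {(i,j). i \<in> {1..k} \<and> j \<in> {1..k} \<and> i \<noteq> j}. \<bar>l i - l j\<bar>) =
      (\<Prod>(i,j)\<in>?U. \<bar>l i - l j\<bar>) * (\<Prod>(i,j)\<in>prod.swap ` ?U. \<bar>l i - l j\<bar>)"
    unfolding U by (rule prod.union_disjoint) (use fin in auto)
  also have "(\<Prod>(i,j)\<in>prod.swap ` ?U. \<bar>l i - l j\<bar>) = (\<Prod>(i,j)\<in>?U. \<bar>l i - l j\<bar>)"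
    by (subst prod.reindex) (auto simp: inj_on_def abs_minus_commute case_prod_unfold)
  finally show ?thesis unfolding P by (simp add: power2_eq_square)
qed

lemma has_bochner_integral_PiM_prod:
  fixes f :: "nat \<Rightarrow> real \<Rightarrow> real"
  assumes "\<And>i. i < k \<Longrightarrow> has_bochner_integral lborel (f i) (c i)"
  shows "has_bochner_integral (Pi\<^sub>M {1..k} (\<lambda>_. lborel))
    (\<lambda>l. \<Prod>i=0..<k. f i (l (Suc i))) (\<Prod>i=0..<k. c i)"
proof -
  interpret product_sigma_finite "\<lambda>_::nat. lborel :: real measure" by standard
  have I: "{1..k} = Suc ` {0..<k}" by (simp add: atLeastLessThanSuc_atLeastAtMost)
  have re: "(\<Prod>i=0..<k. g i (l (Suc i))) = (\<Prod>j\<in>{1..k}. g (j - 1) (l j))" 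
    for g :: "nat \<Rightarrow> real \<Rightarrow> real" and l
    unfolding I by (subst prod.reindex) auto
  have int: "integrable lborel (f (j - 1))" if "j \<in> {1..k}" for j
    using assms[of "j - 1"] that by (auto simp: has_bochner_integral_iff)
  have "(\<Prod>j\<in>{1..k}. integral\<^sup>L lborel (f (j - 1))) = (\<Prod>i=0..<k. c i)"
    unfolding I by (subst prod.reindex) (auto simp: has_bochner_integral_integral_eq[OF assms])
  thus ?thesis unfolding re has_bochner_integral_iff
    using product_integrable_prod[of "{1..k}" "\<lambda>j. f (j - 1)"] int
      product_integral_prod[of "{1..k}" "\<lambda>j. f (j - 1)"] by auto
qed

text \<open>Heine's formula: the squared Vandermonde product is a squared determinant in the p n, up
  to leading coefficients. Expanded over pairs of permutations, the integrals factorise, and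
  orthonormality leaves the k! diagonal terms, each equal to 1. Integrability is part of the claim
  because it is needed later for dominated convergence.\<close>

lemma has_bochner_integral_orthogonal_ensemble:
  assumes orth: "orthonormal_polys W p"
  shows "has_bochner_integral (Pi\<^sub>M {1..k} (\<lambda>_. lborel))
    (\<lambda>l. (\<Prod>j=1..k. W (l j)) *
       (\<Prod>(i,j) \<in> {(i,j). i \<in> {1..k} \<and> j \<in> {1..k} \<and> i \<noteq> j}. \<bar>l i - l j\<bar>))
    (fact k / (\<Prod>n<k. (lead_coeff (p n))\<^sup>2))"
proof -
  define S where "S = {\<sigma>. \<sigma> permutes {0..<k}}"
  have finS: "finite S" by (simp add: S_def finite_permutations)
  define g where "g = (\<Prod>n<k. lead_coeff (p n))"
  have deg: "\<And>j. degree (p j) = j" and pos: "\<And>j. lead_coeff (p j) > 0"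
    using orth unfolding orthonormal_polys_def by blast+
  have g: "g > 0" unfolding g_def using pos by (auto intro!: prod_pos)
  define h where "h \<sigma> \<tau> i x = poly (p (\<sigma> i)) x * poly (p (\<tau> i)) x * W x" for \<sigma> \<tau> :: "nat \<Rightarrow> nat" and i :: nat and x
  define sg :: "(nat \<Rightarrow> nat) \<Rightarrow> real" where "sg \<sigma> = signof \<sigma>" for \<sigma>
  have hint: "has_bochner_integral lborel (h \<sigma> \<tau> i) (if \<sigma> i = \<tau> i then 1 else 0)" for \<sigma> \<tau> i
    unfolding h_def using orth by (auto simp: orthonormal_polys_def)
  have eq: "(\<Prod>j=1..k. W (l j)) *
       (\<Prod>(i,j) \<in> {(i,j). i \<in> {1..k} \<and> j \<in> {1..k} \<and> i \<noteq> j}. \<bar>l i - l j\<bar>) =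
      (\<Sum>\<sigma>\<in>S. \<Sum>\<tau>\<in>S. sg \<sigma> * sg \<tau> * (\<Prod>i=0..<k. h \<sigma> \<tau> i (l (Suc i)))) / g\<^sup>2" for l
  proof -
    have "det (mat k k (\<lambda>(i,j). poly (p j) (l (Suc i)))) = g * (\<Prod>i<k. \<Prod>j<i. l (Suc i) - l (Suc j))"
      unfolding g_def by (rule det_polys_eq_vandermonde) (rule deg)
    also have "det (mat k k (\<lambda>(i,j). poly (p j) (l (Suc i)))) =
        (\<Sum>\<sigma>\<in>S. sg \<sigma> * (\<Prod>i=0..<k. poly (p (\<sigma> i)) (l (Suc i))))"
      unfolding S_def sg_def
      by (subst det_def'[of _ k]) (auto intro!: sum.cong prod.cong simp: permutes_in_image)
    finally have D: "(\<Prod>i<k. \<Prod>j<i. l (Suc i) - l (Suc j)) =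
        (\<Sum>\<sigma>\<in>S. sg \<sigma> * (\<Prod>i=0..<k. poly (p (\<sigma> i)) (l (Suc i)))) / g"
      using g by simp
    have W: "(\<Prod>j=1..k. W (l j)) = (\<Prod>i=0..<k. W (l (Suc i)))"
      by (simp add: prod.atLeast1_atMost_eq atLeast0LessThan)
    show ?thesis
      unfolding prod_abs_diff_off_diagonal D W power2_eq_square h_def
      by (simp add: sum_distrib_left sum_distrib_right prod.distrib sum_product algebra_simps)
  qed
  have "has_bochner_integral (Pi\<^sub>M {1..k} (\<lambda>_. lborel))
     (\<lambda>l. (\<Sum>\<sigma>\<in>S. \<Sum>\<tau>\<in>S. sg \<sigma> * sg \<tau> * (\<Prod>i=0..<k. h \<sigma> \<tau> i (l (Suc i)))) / g\<^sup>2)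
     ((\<Sum>\<sigma>\<in>S. \<Sum>\<tau>\<in>S. sg \<sigma> * sg \<tau> * (\<Prod>i=0..<k. if \<sigma> i = \<tau> i then 1 else 0)) / g\<^sup>2)"
    by (intro has_bochner_integral_divide_zero has_bochner_integral_sum
        has_bochner_integral_mult_right has_bochner_integral_PiM_prod hint)
  also have "(\<Sum>\<sigma>\<in>S. \<Sum>\<tau>\<in>S. sg \<sigma> * sg \<tau> * (\<Prod>i=0..<k. if \<sigma> i = \<tau> i then 1 else 0)) =
      (\<Sum>\<sigma>\<in>S. \<Sum>\<tau>\<in>S. if \<tau> = \<sigma> then 1 else 0)"
  proof (intro sum.cong refl)
    fix \<sigma> \<tau> assume st: "\<sigma> \<in> S" "\<tau> \<in> S"
    have "(\<forall>i\<in>{0..<k}. \<sigma> i = \<tau> i) \<longleftrightarrow> \<tau> = \<sigma>"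
    proof
      assume eq: "\<forall>i\<in>{0..<k}. \<sigma> i = \<tau> i"
      show "\<tau> = \<sigma>"
      proof
        fix i show "\<tau> i = \<sigma> i"
        proof (cases "i \<in> {0..<k}")
          case False
          thus ?thesis using st permutes_not_in[of \<sigma> "{0..<k}" i] permutes_not_in[of \<tau> "{0..<k}" i]
            by (simp add: S_def)
        qed (use eq in simp)
      qed
    qed simp
    thus "sg \<sigma> * sg \<tau> * (\<Prod>i=0..<k. if \<sigma> i = \<tau> i then 1 else 0) = (if \<tau> = \<sigma> then 1 else 0)"
      by (auto simp: sg_def sign_def) 
  qed
  also have "\<dots> = fact k"
    using finS by (simp add: S_def card_permutations[of "{0..<k}" k])
  finally show ?thesis unfolding eq by (simp add: g_def prod_power_distrib)
qed

section \<open>Orthonormal polynomials and the Gaussian weight\<close>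

text \<open>The span of p 0, ..., p (m-1) as an induction principle, usable for any property stable
  under linear combinations. The coefficient condition, unlike a strict degree bound, also makes
  sense for m = 0, where it forces q = 0.\<close>

lemma poly_span_induct:
  fixes p :: "nat \<Rightarrow> 'a::field poly"
  assumes deg: "\<And>n. degree (p n) = n" and nz: "\<And>n. lead_coeff (p n) \<noteq> 0"
    and q: "\<And>i. i \<ge> m \<Longrightarrow> coeff q i = 0"
    and zero: "Q 0" and base: "\<And>n. n < m \<Longrightarrow> Q (p n)"
    and step: "\<And>c q r. Q q \<Longrightarrow> Q r \<Longrightarrow> Q (smult c q + r)"
  shows "Q q"
  using q base
proof (induction m arbitrary: q)
  case 0
  hence "q = 0" by (intro poly_eqI) auto
  thus ?case using zero by simp
next
  case (Suc m)
  define c where "c = coeff q m / lead_coeff (p m)"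
  have pm: "coeff (p m) m \<noteq> 0" using nz[of m] deg[of m] by simp
  have "Q (q - smult c (p m))"
  proof (rule Suc.IH)
    fix i assume i: "m \<le> i"
    show "coeff (q - smult c (p m)) i = 0"
    proof (cases "i = m")
      case True
      thus ?thesis using pm deg[of m] by (simp add: c_def)
    next
      case False
      thus ?thesis using i Suc.prems(1)[of i] deg[of m] by (simp add: coeff_eq_0)
    qed
  qed (use Suc.prems in auto)
  hence "Q (smult c (p m) + (q - smult c (p m)))" by (intro step Suc.prems) auto
  thus ?case by simp
qed

lemma orthonormal_polys_degree:
  assumes "orthonormal_polys W p" shows "degree (p n) = n" "lead_coeff (p n) > 0" "coeff (p n) n > 0"
  using assms unfolding orthonormal_polys_def by metis+

lemma orthonormal_polys_integrable:
  assumes orth: "orthonormal_polys W p"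
  shows "integrable lborel (\<lambda>x. poly q x * W x)"
proof (rule poly_span_induct[where p = p and m = "Suc (degree q)" and q = q])
  fix n
  \<comment> \<open>Since p 0 is a nonzero constant c, integrability of p n * W follows from that of
    p n * p 0 * W.\<close>
  obtain c where c: "p 0 = [:c:]" using orthonormal_polys_degree(1)[OF orth, of 0]
    by (rule degree_eq_zeroE)
  hence "c \<noteq> 0" using orthonormal_polys_degree(3)[OF orth, of 0] by auto
  have "integrable lborel (\<lambda>x. (1 / c) * (poly (p n) x * poly (p 0) x * W x))"
    using orth by (intro integrable_mult_right) (auto simp: orthonormal_polys_def has_bochner_integral_iff)
  thus "integrable lborel (\<lambda>x. poly (p n) x * W x)" using \<open>c \<noteq> 0\<close> by (simp add: c)
next
  fix c and q r :: "real poly"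
  assume "integrable lborel (\<lambda>x. poly q x * W x)" "integrable lborel (\<lambda>x. poly r x * W x)"
  hence "integrable lborel (\<lambda>x. c * (poly q x * W x) + poly r x * W x)" by simp
  thus "integrable lborel (\<lambda>x. poly (smult c q + r) x * W x)" by (simp add: algebra_simps)
qed (use orthonormal_polys_degree[OF orth] in \<open>auto simp: coeff_eq_0 less_imp_neq[symmetric]\<close>)

text \<open>Subtracting the right multiple of p n from q leaves a combination of the lower
  polynomials, which are orthogonal to p n. Polynomials q of degree below n are covered too and give
  0.\<close>

lemma orthonormal_polys_integral_top:
  assumes orth: "orthonormal_polys W p" and q: "\<And>i. i > n \<Longrightarrow> coeff q i = 0"
  shows "(\<integral>x. poly q x * poly (p n) x * W x \<partial>lborel) = coeff q n / lead_coeff (p n)"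
proof -
  note deg = orthonormal_polys_degree[OF orth]
  have int: "integrable lborel (\<lambda>x. poly q x * poly (p n) x * W x)" for q
    using orthonormal_polys_integrable[OF orth, of "q * p n"] by simp
  have low: "(\<integral>x. poly q x * poly (p n) x * W x \<partial>lborel) = 0"
    if "\<And>i. i \<ge> n \<Longrightarrow> coeff q i = 0" for q
  proof (rule poly_span_induct[where p = p and m = n and q = q])
    show "(\<integral>x. poly (p m) x * poly (p n) x * W x \<partial>lborel) = 0" if "m < n" for m
      using orth that by (auto simp: orthonormal_polys_def has_bochner_integral_iff)
    show "(\<integral>x. poly (smult c q + r) x * poly (p n) x * W x \<partial>lborel) = 0"
      if "(\<integral>x. poly q x * poly (p n) x * W x \<partial>lborel) = 0"
         "(\<integral>x. poly r x * poly (p n) x * W x \<partial>lborel) = 0" for c q r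
    proof -
      have "(\<integral>x. poly (smult c q + r) x * poly (p n) x * W x \<partial>lborel) =
        (\<integral>x. c * (poly q x * poly (p n) x * W x) + poly r x * poly (p n) x * W x \<partial>lborel)"
        by (simp add: algebra_simps)
      thus ?thesis using that int by simp
    qed
  qed (use deg that in \<open>auto simp: less_imp_neq[symmetric]\<close>)
  define c where "c = coeff q n / lead_coeff (p n)"
  have "(\<integral>x. poly (q - smult c (p n)) x * poly (p n) x * W x \<partial>lborel) = 0"
  proof (rule low)
    fix i assume "i \<ge> n"
    thus "coeff (q - smult c (p n)) i = 0"
      using q[of i] deg(1,3)[of n] by (cases "i = n") (auto simp: c_def coeff_eq_0)
  qed
  also have "(\<integral>x. poly (q - smult c (p n)) x * poly (p n) x * W x \<partial>lborel) =
      (\<integral>x. poly q x * poly (p n) x * W x - c * (poly (p n) x * poly (p n) x * W x) \<partial>lborel)"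
    by (simp add: algebra_simps)
  also have "\<dots> = (\<integral>x. poly q x * poly (p n) x * W x \<partial>lborel) - c"
    using int orth by (subst Bochner_Integration.integral_diff)
      (auto simp: orthonormal_polys_def has_bochner_integral_iff)
  finally show ?thesis by (simp add: c_def)
qed

section \<open>Integration by parts against the Gaussian and its recurrence coefficients\<close>

lemma poly_times_gaussian_tendsto_0:
  fixes q :: "real poly"
  shows "((\<lambda>x. poly q x * exp (- (1/2) * x^2)) \<longlongrightarrow> 0) at_top"
    and "((\<lambda>x. poly q x * exp (- (1/2) * x^2)) \<longlongrightarrow> 0) at_bot"
proof -
  have *: "((\<lambda>x. poly q x * exp (- (1/2) * x^2)) \<longlongrightarrow> 0) at_top" for q :: "real poly"
  proof -
    have "((\<lambda>x::real. x ^ n * exp (- (1/2) * x^2)) \<longlongrightarrow> 0) at_top" for n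
      by real_asymp
    hence "((\<lambda>x. \<Sum>i\<le>degree q. coeff q i * (x ^ i * exp (- (1/2) * x^2))) \<longlongrightarrow> (\<Sum>i\<le>degree q. coeff q i * 0)) at_top"
      by (intro tendsto_sum tendsto_mult tendsto_const)
    thus ?thesis by (simp add: poly_altdef sum_distrib_right mult.assoc)
  qed
  show "((\<lambda>x. poly q x * exp (- (1/2) * x^2)) \<longlongrightarrow> 0) at_top" by (rule *)
  show "((\<lambda>x. poly q x * exp (- (1/2) * x^2)) \<longlongrightarrow> 0) at_bot"
    unfolding filterlim_at_bot_mirror using *[of "pcompose q [:0, -1:]"] by (simp add: poly_pcompose)
qed

text \<open>The integrand is the derivative of q(x) exp(-x^2/2), which vanishes at both ends of the
  line.\<close>

lemma integral_deriv_poly_gaussian: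
  fixes q :: "real poly"
  assumes "\<And>q :: real poly. integrable lborel (\<lambda>x. poly q x * exp (- (1/2) * x^2))"
  shows "(\<integral>x. poly (pderiv q - [:0, 1:] * q) x * exp (- (1/2) * x^2) \<partial>lborel) = 0"
proof -
  have "(LBINT x=-\<infinity>..\<infinity>. poly (pderiv q - [:0, 1:] * q) x * exp (- (1/2) * x^2)) = 0 - 0"
  proof (rule interval_integral_FTC_integrable[where F = "\<lambda>x. poly q x * exp (- (1/2) * x^2)"])
    show "((\<lambda>x. poly q x * exp (- (1/2) * x^2)) has_vector_derivative
        poly (pderiv q - [:0, 1:] * q) x * exp (- (1/2) * x^2)) (at x)" for x
      unfolding has_real_derivative_iff_has_vector_derivative[symmetric]
      by (auto intro!: derivative_eq_intros poly_DERIV simp: algebra_simps)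
    show "set_integrable lborel (einterval (-\<infinity>) \<infinity>) (\<lambda>x. poly (pderiv q - [:0, 1:] * q) x * exp (- (1/2) * x^2))"
      using assms[of "pderiv q - [:0, 1:] * q"] by (simp add: set_integrable_def)
    show "(((\<lambda>x. poly q x * exp (- (1/2) * x^2)) \<circ> real_of_ereal) \<longlongrightarrow> 0) (at_right (-\<infinity>))"
      unfolding ereal_tendsto_simps by (rule poly_times_gaussian_tendsto_0)
    show "(((\<lambda>x. poly q x * exp (- (1/2) * x^2)) \<circ> real_of_ereal) \<longlongrightarrow> 0) (at_left \<infinity>)"
      unfolding ereal_tendsto_simps by (rule poly_times_gaussian_tendsto_0)
  qed (auto intro!: continuous_intros)
  thus ?thesis by (simp add: interval_integral_to_infinity_eq interval_lebesgue_integral_def set_lebesgue_integral_def)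
qed

lemma recurrence_coeffs_lead:
  assumes orth: "orthonormal_polys W p"
    and rec0: "[:0, 1:] * p 0 = smult (\<beta> 1) (p 1)"
    and rec: "\<And>n. n \<ge> 1 \<Longrightarrow> [:0, 1:] * p n = smult (\<beta> (n + 1)) (p (n + 1)) + smult (\<beta> n) (p (n - 1))"
  shows "lead_coeff (p n) = \<beta> (Suc n) * lead_coeff (p (Suc n))"
proof -
  note deg = orthonormal_polys_degree[OF orth]
  have "coeff ([:0, 1:] * p n) (Suc n) = \<beta> (Suc n) * coeff (p (Suc n)) (Suc n)"
  proof (cases "n = 0")
    case True
    thus ?thesis using rec0 by simp
  next
    case False
    have "coeff (p (n - 1)) (Suc n) = 0" by (rule coeff_eq_0) (simp add: deg)
    thus ?thesis using rec[of n] False by simp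
  qed
  thus ?thesis by (simp add: deg)
qed

text \<open>No explicit Hermite polynomials are used. Integrating the derivative of p n * p (n-1) *
  W gives n B/A - A/B = 0 for the leading coefficients A of p (n-1) and B of p n, and A/B is the
  recurrence coefficient.\<close>

lemma gaussian_recurrence_coeffs:
  assumes "recurrence_coeffs (\<lambda>x. exp (- (1/2) * x^2)) \<beta>" and n: "n \<ge> 1"
  shows "(\<beta> n)\<^sup>2 = real n"
proof -
  define W :: "real \<Rightarrow> real" where "W = (\<lambda>x. exp (- (1/2) * x^2))"
  obtain p where orth: "orthonormal_polys W p"
    and rec: "[:0, 1:] * p 0 = smult (\<beta> 1) (p 1)"
      "\<And>n. n \<ge> 1 \<Longrightarrow> [:0, 1:] * p n = smult (\<beta> (n + 1)) (p (n + 1)) + smult (\<beta> n) (p (n - 1))"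
    using assms unfolding recurrence_coeffs_def W_def by blast
  note deg = orthonormal_polys_degree[OF orth]
  note int = orthonormal_polys_integrable[OF orth]
  obtain m where m: "n = Suc m" using n by (cases n) auto
  define A B where "A = lead_coeff (p m)" and "B = lead_coeff (p n)"
  have AB: "A > 0" "B > 0" using deg by (auto simp: A_def B_def)
  have "0 = (\<integral>x. poly (pderiv (p n * p m) - [:0, 1:] * (p n * p m)) x * W x \<partial>lborel)"
    using integral_deriv_poly_gaussian[of "p n * p m"] int unfolding W_def by metis
  also have "\<dots> = (\<integral>x. poly (pderiv (p n)) x * poly (p m) x * W x +
      poly (pderiv (p m)) x * poly (p n) x * W x - poly ([:0, 1:] * p m) x * poly (p n) x * W x \<partial>lborel)"
    by (intro Bochner_Integration.integral_cong refl) (simp add: pderiv_mult algebra_simps)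
  also have "\<dots> = (\<integral>x. poly (pderiv (p n)) x * poly (p m) x * W x \<partial>lborel) +
      (\<integral>x. poly (pderiv (p m)) x * poly (p n) x * W x \<partial>lborel) -
      (\<integral>x. poly ([:0, 1:] * p m) x * poly (p n) x * W x \<partial>lborel)"
    using int[of "pderiv (p n) * p m"] int[of "pderiv (p m) * p n"] int[of "[:0, 1:] * p m * p n"]
    by (simp add: mult.assoc)
  also have "(\<integral>x. poly (pderiv (p n)) x * poly (p m) x * W x \<partial>lborel) = real n * B / A"
    using deg(1)[of n] unfolding A_def B_def
    by (subst orthonormal_polys_integral_top[OF orth]) (auto simp: coeff_pderiv coeff_eq_0 m)
  also have "(\<integral>x. poly (pderiv (p m)) x * poly (p n) x * W x \<partial>lborel) = 0"
    using deg(1)[of m]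
    by (subst orthonormal_polys_integral_top[OF orth]) (auto simp: coeff_pderiv coeff_eq_0 m)
  also have "(\<integral>x. poly ([:0, 1:] * p m) x * poly (p n) x * W x \<partial>lborel) = A / B"
    using deg(1)[of m] unfolding A_def B_def
    by (subst orthonormal_polys_integral_top[OF orth]) (auto simp: coeff_pCons coeff_eq_0 m split: nat.splits)
  finally have "real n = (A / B)\<^sup>2" using AB by (simp add: field_simps power2_eq_square)
  moreover have "A = \<beta> n * B"
    unfolding A_def B_def m by (rule recurrence_coeffs_lead[OF orth rec])
  ultimately show ?thesis using AB by simp
qed

text \<open>The factor sqrt a restores the unit norms after the substitution, whose Jacobian is a.
  The ensemble integral only sees the leading coefficients.\<close>

lemma orthonormal_polys_rescale:
  assumes orth: "orthonormal_polys W p" and a: "a > 0"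
  shows "orthonormal_polys (\<lambda>x. W (a * x)) (\<lambda>n. smult (sqrt a) (pcompose (p n) [:0, a:]))"
    and "lead_coeff (smult (sqrt a) (pcompose (p n) [:0, a:])) = sqrt a * a ^ n * lead_coeff (p n)"
proof -
  note deg = orthonormal_polys_degree[OF orth]
  have lc: "lead_coeff (smult (sqrt a) (pcompose (p n) [:0, a:])) = sqrt a * a ^ n * lead_coeff (p n)" for n
    using a deg(1)[of n] by (subst lead_coeff_smult, subst lead_coeff_comp) auto
  show "lead_coeff (smult (sqrt a) (pcompose (p n) [:0, a:])) = sqrt a * a ^ n * lead_coeff (p n)" by (rule lc)
  have lcpos: "lead_coeff (smult (sqrt a) (pcompose (p n) [:0, a:])) > 0" for n
    unfolding lc using a deg(2)[of n] by simp
  have dg: "degree (smult (sqrt a) (pcompose (p n) [:0, a:])) = n" for n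
    using a deg(1)[of n] by (simp add: degree_pcompose)
  have int: "has_bochner_integral lborel
      (\<lambda>x. poly (smult (sqrt a) (pcompose (p m) [:0, a:])) x *
           poly (smult (sqrt a) (pcompose (p n) [:0, a:])) x * W (a * x)) (if m = n then 1 else 0)" for m n
  proof -
    have "has_bochner_integral lborel (\<lambda>x. poly (p m) x * poly (p n) x * W x) (if m = n then 1 else 0)"
      using orth by (auto simp: orthonormal_polys_def)
    hence "has_bochner_integral lborel (\<lambda>x. poly (p m) (a * x) * poly (p n) (a * x) * W (a * x))
        ((if m = n then 1 else 0) /\<^sub>R \<bar>a\<bar>)"
      using a by (subst (asm) lborel_has_bochner_integral_real_affine_iff[of a _ _ 0]) auto
    hence "has_bochner_integral lborel (\<lambda>x. a * (poly (p m) (a * x) * poly (p n) (a * x) * W (a * x)))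
        (a * ((if m = n then 1 else 0) /\<^sub>R \<bar>a\<bar>))"
      by (intro has_bochner_integral_mult_right) auto
    moreover have "a * ((if m = n then 1 else 0) /\<^sub>R \<bar>a\<bar>) = (if m = n then 1 else 0)"
      using a by auto
    moreover have "a * (poly (p m) (a * x) * poly (p n) (a * x) * W (a * x)) =
       poly (smult (sqrt a) (pcompose (p m) [:0, a:])) x *
           poly (smult (sqrt a) (pcompose (p n) [:0, a:])) x * W (a * x)" for x
    proof -
      have "a = sqrt a * sqrt a" using a by simp
      thus ?thesis by (simp add: poly_pcompose algebra_simps)
    qed
    ultimately show ?thesis by (simp only:)
  qed
  show "orthonormal_polys (\<lambda>x. W (a * x)) (\<lambda>n. smult (sqrt a) (pcompose (p n) [:0, a:]))"
    unfolding orthonormal_polys_def using dg lcpos int by blast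
qed

section \<open>The partition function\<close>

lemma even_weight_0: "even_weight \<nu> 0 = (\<lambda>x. exp (- (1/2) * x^2))"
  by (auto simp: even_weight_def)

text \<open>The power 2\<nu> of sqrt k is k^\<nu>. One factor k is the prefactor of the exponent;
  the remaining k^(\<nu>-1) fixes the relation between t and \<xi>.\<close>

lemma partition_function_weight_eq:
  fixes l :: "nat \<Rightarrow> real"
  assumes nu: "\<nu> \<ge> 1" and t: "t = - 2 * \<xi> * real k ^ (\<nu> - 1)"
  shows "exp (- real k * (\<Sum>j=1..k. (1/2) * (l j)^2 + t * (l j)^(2*\<nu>))) =
    (\<Prod>j=1..k. even_weight \<nu> \<xi> (sqrt (real k) * l j))"
proof -
  have "- real k * ((1/2) * x^2 + t * x^(2*\<nu>)) =
      - (1/2) * (sqrt (real k) * x)^2 + 2 * \<xi> * (sqrt (real k) * x)^(2*\<nu>)" for x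
  proof -
    have "(sqrt (real k) * x)^(2*\<nu>) = real k ^ \<nu> * x^(2*\<nu>)"
      by (simp add: power_mult_distrib power_mult)
    also have "real k ^ \<nu> = real k * real k ^ (\<nu> - 1)"
      using nu by (cases \<nu>) auto
    finally have 1: "(sqrt (real k) * x)^(2*\<nu>) = real k * real k ^ (\<nu> - 1) * x^(2*\<nu>)" .
    have 2: "(sqrt (real k) * x)^2 = real k * x^2" by (simp add: power_mult_distrib)
    show ?thesis unfolding 1 2 t by (simp add: algebra_simps)
  qed
  thus ?thesis by (simp only: sum_distrib_left exp_sum finite_atLeastAtMost even_weight_def)
qed

lemma has_bochner_integral_partition_function:
  assumes nu: "\<nu> \<ge> 1" and k: "k \<ge> 1" and t: "t = - 2 * \<xi> * real k ^ (\<nu> - 1)"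
    and orth: "orthonormal_polys (even_weight \<nu> \<xi>) p"
  shows "has_bochner_integral (Pi\<^sub>M {1..k} (\<lambda>_. lborel))
    (\<lambda>l. exp (- real k * (\<Sum>j=1..k. (1/2) * (l j)^2 + t * (l j)^(2*\<nu>)))
          * (\<Prod>(i,j) \<in> {(i,j). i \<in> {1..k} \<and> j \<in> {1..k} \<and> i \<noteq> j}. \<bar>l i - l j\<bar>))
    (fact k / ((\<Prod>n<k. (sqrt (sqrt (real k)) * sqrt (real k) ^ n)\<^sup>2) * (\<Prod>n<k. (lead_coeff (p n))\<^sup>2)))"
proof -
  have k0: "sqrt (real k) > 0" using k by simp
  from has_bochner_integral_orthogonal_ensemble[OF orthonormal_polys_rescale(1)[OF orth k0], of k]
  show ?thesis
    unfolding partition_function_weight_eq[OF nu t]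
    by (simp only: orthonormal_polys_rescale(2)[OF orth k0] power_mult_distrib prod.distrib)
qed

lemma partition_function_eq:
  assumes "\<nu> \<ge> 1" "k \<ge> 1" "t = - 2 * \<xi> * real k ^ (\<nu> - 1)" "orthonormal_polys (even_weight \<nu> \<xi>) p"
  shows "partition_function \<nu> k t =
    fact k / ((\<Prod>n<k. (sqrt (sqrt (real k)) * sqrt (real k) ^ n)\<^sup>2) * (\<Prod>n<k. (lead_coeff (p n))\<^sup>2))"
  unfolding partition_function_def
  by (rule has_bochner_integral_integral_eq[OF has_bochner_integral_partition_function[OF assms]])

text \<open>The factorial and the scaling factors depend on k alone and cancel in the ratio. What
  remains is a partial sum whose summands do not involve k once \<xi> is fixed, which is why
  differences in k at fixed \<xi> are simple.\<close>

lemma ln_partition_function_ratio: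
  assumes nu: "\<nu> \<ge> 1" and k: "k \<ge> 1" and t: "t = - 2 * \<xi> * real k ^ (\<nu> - 1)"
    and orth: "orthonormal_polys (even_weight \<nu> \<xi>) p" and orth0: "orthonormal_polys (even_weight \<nu> 0) q"
  shows "ln (partition_function \<nu> k t / partition_function \<nu> k 0) =
    (\<Sum>n<k. ln ((lead_coeff (q n))\<^sup>2) - ln ((lead_coeff (p n))\<^sup>2))"
proof -
  note P = orthonormal_polys_degree(2)[OF orth] and Q = orthonormal_polys_degree(2)[OF orth0]
  define c where "c = (\<Prod>n<k. (sqrt (sqrt (real k)) * sqrt (real k) ^ n)\<^sup>2)"
  have "c \<noteq> 0" using k by (simp add: c_def)
  have Pp: "(\<Prod>n<k. (lead_coeff (p n))\<^sup>2) > 0" by (intro prod_pos ballI zero_less_power P)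
  have Qp: "(\<Prod>n<k. (lead_coeff (q n))\<^sup>2) > 0" by (intro prod_pos ballI zero_less_power Q)
  have nz: "p n \<noteq> 0" "q n \<noteq> 0" for n using P[of n] Q[of n] by auto
  have "partition_function \<nu> k t / partition_function \<nu> k 0 =
     (\<Prod>n<k. (lead_coeff (q n))\<^sup>2) / (\<Prod>n<k. (lead_coeff (p n))\<^sup>2)"
    using partition_function_eq[OF nu k t orth] partition_function_eq[OF nu k _ orth0, of 0] \<open>c \<noteq> 0\<close> Pp Qp
    by (simp add: c_def[symmetric] field_simps)
  also have "ln \<dots> = ln (\<Prod>n<k. (lead_coeff (q n))\<^sup>2) - ln (\<Prod>n<k. (lead_coeff (p n))\<^sup>2)"
    using Pp Qp by (rule ln_divide_pos[rotated])
  also have "\<dots> = (\<Sum>n<k. ln ((lead_coeff (q n))\<^sup>2)) - (\<Sum>n<k. ln ((lead_coeff (p n))\<^sup>2))"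
    by (subst (1 2) ln_prod) (auto simp: nz)
  finally show ?thesis by (simp add: sum_subtractf)
qed

lemma partition_function_second_difference:
  assumes nu: "\<nu> \<ge> 1" and k: "k \<ge> 2"
    and rec: "recurrence_coeffs (even_weight \<nu> (s / (2 * real k ^ (\<nu> - 1)))) \<beta>"
    and rec0: "recurrence_coeffs (even_weight \<nu> 0) \<beta>\<^sub>0"
  defines "f \<equiv> (\<lambda>j t. ln (partition_function \<nu> j t / partition_function \<nu> j 0))"
  shows "f (k + 1) (- (s * (real (k + 1) / real k) ^ (\<nu> - 1))) +
         f (k - 1) (- (s * (real (k - 1) / real k) ^ (\<nu> - 1))) - 2 * f k (- s) =
         ln ((\<beta> k)\<^sup>2 / real k)"
proof -
  define \<xi> where "\<xi> = s / (2 * real k ^ (\<nu> - 1))"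
  obtain p where p: "orthonormal_polys (even_weight \<nu> \<xi>) p"
      "[:0, 1:] * p 0 = smult (\<beta> 1) (p 1)"
      "\<And>n. n \<ge> 1 \<Longrightarrow> [:0, 1:] * p n = smult (\<beta> (n + 1)) (p (n + 1)) + smult (\<beta> n) (p (n - 1))"
    and bpos: "\<And>n. n \<ge> 1 \<Longrightarrow> \<beta> n > 0"
    using rec unfolding recurrence_coeffs_def \<xi>_def by blast
  obtain q where q: "orthonormal_polys (even_weight \<nu> 0) q"
      "[:0, 1:] * q 0 = smult (\<beta>\<^sub>0 1) (q 1)"
      "\<And>n. n \<ge> 1 \<Longrightarrow> [:0, 1:] * q n = smult (\<beta>\<^sub>0 (n + 1)) (q (n + 1)) + smult (\<beta>\<^sub>0 n) (q (n - 1))"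
    and bpos0: "\<And>n. n \<ge> 1 \<Longrightarrow> \<beta>\<^sub>0 n > 0"
    using rec0 unfolding recurrence_coeffs_def by blast
  define u where "u n = ln ((lead_coeff (q n))\<^sup>2) - ln ((lead_coeff (p n))\<^sup>2)" for n
  \<comment> \<open>All three particle numbers share the weight parameter \<xi>; only the
    corresponding time depends on j. The second difference of these partial sums is u k - u
    (k-1).\<close>
  have f: "f j (- (s * (real j / real k) ^ (\<nu> - 1))) = (\<Sum>n<j. u n)" if "j \<ge> 1" for j
    unfolding f_def u_def
    by (rule ln_partition_function_ratio[OF nu that _ p(1) q(1)])
       (use k that in \<open>auto simp: \<xi>_def power_divide field_simps\<close>)
  obtain m where m: "k = Suc m" using k by (cases k) auto
  have "f (k + 1) (- (s * (real (k + 1) / real k) ^ (\<nu> - 1))) +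
         f (k - 1) (- (s * (real (k - 1) / real k) ^ (\<nu> - 1))) - 2 * f k (- s) = u k - u m"
    using f[of "k + 1"] f[of "k - 1"] f[of k] k by (simp add: m)
  also have "\<dots> = ln ((\<beta> k)\<^sup>2) - ln ((\<beta>\<^sub>0 k)\<^sup>2)"
  proof -
    note P = orthonormal_polys_degree(2)[OF p(1), of k] and Q = orthonormal_polys_degree(2)[OF q(1), of k]
    have "ln ((lead_coeff (p m))\<^sup>2) = ln ((\<beta> k)\<^sup>2) + ln ((lead_coeff (p k))\<^sup>2)"
      using recurrence_coeffs_lead[OF p, of m] bpos[of k] k P
      unfolding m[symmetric] by (simp only: power_mult_distrib) (intro ln_mult_pos zero_less_power; simp)
    moreover have "ln ((lead_coeff (q m))\<^sup>2) = ln ((\<beta>\<^sub>0 k)\<^sup>2) + ln ((lead_coeff (q k))\<^sup>2)"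
      using recurrence_coeffs_lead[OF q, of m] bpos0[of k] k Q
      unfolding m[symmetric] by (simp only: power_mult_distrib) (intro ln_mult_pos zero_less_power; simp)
    ultimately show ?thesis by (simp add: u_def)
  qed
  also have "(\<beta>\<^sub>0 k)\<^sup>2 = real k"
    using rec0 k unfolding even_weight_0 by (intro gaussian_recurrence_coeffs) auto
  also have "ln ((\<beta> k)\<^sup>2) - ln (real k) = ln ((\<beta> k)\<^sup>2 / real k)"
    using bpos[of k] k by (subst ln_divide_pos) auto
  finally show ?thesis .
qed

text \<open>This makes the logarithm continuous in t, as Baire's theorem requires. Positivity is
  read off Heine's formula; continuity is dominated convergence, with the integrand at t = 0 as
  majorant because t >= 0 multiplies even powers.\<close>

lemma partition_function_pos_continuous:
  assumes nu: "\<nu> \<ge> 1" and k: "k \<ge> 1"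
    and orth: "\<And>\<xi>. \<xi> \<le> 0 \<Longrightarrow> \<exists>p. orthonormal_polys (even_weight \<nu> \<xi>) p"
  shows "\<And>t. t \<ge> 0 \<Longrightarrow> partition_function \<nu> k t > 0"
    and "continuous_on {0..} (partition_function \<nu> k)"
proof -
  define F where "F t l = exp (- real k * (\<Sum>j=1..k. (1/2) * (l j)^2 + t * (l j)^(2*\<nu>)))
          * (\<Prod>(i,j) \<in> {(i,j). i \<in> {1..k} \<and> j \<in> {1..k} \<and> i \<noteq> j}. \<bar>l i - l j\<bar>)"
    for t and l :: "nat \<Rightarrow> real"
  define xi where "xi t = - t / (2 * real k ^ (\<nu> - 1))" for t
  have xi: "t = - 2 * xi t * real k ^ (\<nu> - 1)" for t
    using k by (simp add: xi_def)
  have xi_le: "xi t \<le> 0" if "t \<ge> 0" for t using that by (simp add: xi_def)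
  have int: "integrable (Pi\<^sub>M {1..k} (\<lambda>_. lborel)) (F t)" if "t \<ge> 0" for t
    using orth[OF xi_le[OF that]] has_bochner_integral_partition_function[OF nu k xi[of t]]
    unfolding F_def has_bochner_integral_iff by blast
  show "partition_function \<nu> k t > 0" if t: "t \<ge> 0" for t
  proof -
    obtain p where p: "orthonormal_polys (even_weight \<nu> (xi t)) p" using orth[OF xi_le[OF t]] by blast
    have "(\<Prod>n<k. (lead_coeff (p n))\<^sup>2) > 0"
      by (intro prod_pos ballI zero_less_power orthonormal_polys_degree(2)[OF p])
    moreover have "(\<Prod>n<k. (sqrt (sqrt (real k)) * sqrt (real k) ^ n)\<^sup>2) > 0"
      using k by (intro prod_pos) auto
    ultimately show ?thesis
      unfolding partition_function_eq[OF nu k xi p] by (intro divide_pos_pos mult_pos_pos) auto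
  qed
  have "(\<lambda>n. integral\<^sup>L (Pi\<^sub>M {1..k} (\<lambda>_. lborel)) (F (X n))) \<longlonglongrightarrow>
      integral\<^sup>L (Pi\<^sub>M {1..k} (\<lambda>_. lborel)) (F a)"
    if a: "a \<ge> 0" and X: "\<And>n. X n \<ge> 0" "X \<longlonglongrightarrow> a" for X a
  proof (rule integral_dominated_convergence[where w = "F 0"])
    show "AE l in Pi\<^sub>M {1..k} (\<lambda>_. lborel). (\<lambda>n. F (X n) l) \<longlonglongrightarrow> F a l"
      unfolding F_def by (intro AE_I2 tendsto_intros X)
    show "AE l in Pi\<^sub>M {1..k} (\<lambda>_. lborel). norm (F (X n) l) \<le> F 0 l" for n
    proof (rule AE_I2)
      fix l :: "nat \<Rightarrow> real"
      define V where "V = (\<Prod>(i,j) \<in> {(i,j). i \<in> {1..k} \<and> j \<in> {1..k} \<and> i \<noteq> j}. \<bar>l i - l j\<bar>)"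
      have V: "V \<ge> 0" unfolding V_def by (intro prod_nonneg) auto
      have "(\<Sum>j=1..k. (1/2) * (l j)^2 + 0 * (l j)^(2*\<nu>)) \<le> (\<Sum>j=1..k. (1/2) * (l j)^2 + X n * (l j)^(2*\<nu>))"
        using X(1)[of n] by (intro sum_mono add_left_mono mult_right_mono) auto
      hence "- real k * (\<Sum>j=1..k. (1/2) * (l j)^2 + X n * (l j)^(2*\<nu>)) \<le>
          - real k * (\<Sum>j=1..k. (1/2) * (l j)^2 + 0 * (l j)^(2*\<nu>))"
        by (intro mult_left_mono_neg) auto
      hence "F (X n) l \<le> F 0 l" unfolding F_def V_def[symmetric]
        by (intro mult_right_mono V) (simp only: exp_le_cancel_iff)
      moreover have "F (X n) l \<ge> 0" unfolding F_def V_def[symmetric] using V by simp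
      ultimately show "norm (F (X n) l) \<le> F 0 l" by simp
    qed
  qed (use int a X in \<open>auto intro: borel_measurable_integrable\<close>)
  thus "continuous_on {0..} (partition_function \<nu> k)"
    unfolding continuous_on_sequentially partition_function_def F_def[symmetric] by (auto simp: o_def)
qed

section \<open>Holomorphic dependence on the parameter\<close>

text \<open>A class containing \<open>\<lambda>s w. w powi p * f (- w^q * s)\<close> and closed under \<open>\<partial>/\<partial>w\<close>, whose members are
  holomorphic in \<open>s\<close>; hence so are all \<open>w\<close>-derivatives of that function.\<close>

inductive_set euler_terms :: "nat \<Rightarrow> (complex \<Rightarrow> complex) \<Rightarrow> (complex \<Rightarrow> complex \<Rightarrow> complex) set"
  for q :: nat and f :: "complex \<Rightarrow> complex" where
  monomial: "(\<lambda>s w. c * s ^ i * w powi p * (deriv ^^ j) f (- (w ^ q) * s)) \<in> euler_terms q f"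
| add: "F \<in> euler_terms q f \<Longrightarrow> G \<in> euler_terms q f \<Longrightarrow> (\<lambda>s w. F s w + G s w) \<in> euler_terms q f"

text \<open>The disc of radius 2 is a convenient neighbourhood of w = 1, and it accounts for the
  factor 2^q by which the radius in s shrinks.\<close>

lemma power_times_in_ball:
  fixes s w :: complex
  assumes "norm w < 2" "norm s < r / 2 ^ q"
  shows "- (w ^ q) * s \<in> ball 0 r"
proof -
  have "norm (w ^ q * s) \<le> 2 ^ q * norm s"
    unfolding norm_mult norm_power using assms by (intro mult_right_mono power_mono) auto
  also have "\<dots> < r" using assms by (simp add: field_simps)
  finally show ?thesis by simp
qed

lemma euler_terms_deriv:
  assumes f: "f holomorphic_on ball 0 r" and F: "F \<in> euler_terms q f"
  shows "\<exists>F'\<in>euler_terms q f. \<forall>s w. norm s < r / 2 ^ q \<longrightarrow> norm w < 2 \<longrightarrow> w \<noteq> 0 \<longrightarrow>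
    (F s has_field_derivative F' s w) (at w)"
  using F
proof induction
  case (monomial c i p j)
  \<comment> \<open>Product and chain rule. For q = 0 the truncated q - 1 is harmless, since the
    second term then has coefficient 0.\<close>
  let ?F' = "\<lambda>s w. c * of_int p * s ^ i * w powi (p - 1) * (deriv ^^ j) f (- (w ^ q) * s) +
    (- c * of_nat q) * s ^ Suc i * w powi (p + int (q - 1)) * (deriv ^^ Suc j) f (- (w ^ q) * s)"
  have "?F' \<in> euler_terms q f" by (intro euler_terms.intros)
  moreover have "((\<lambda>w. c * s ^ i * w powi p * (deriv ^^ j) f (- (w ^ q) * s)) has_field_derivative ?F' s w) (at w)"
    if "norm s < r / 2 ^ q" "norm w < 2" "w \<noteq> 0" for s w
  proof -
    have D: "((deriv ^^ j) f has_field_derivative (deriv ^^ Suc j) f (- (w ^ q) * s)) (at (- (w ^ q) * s))"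
      using power_times_in_ball[OF that(2,1)] holomorphic_higher_deriv[OF f]
      by (auto intro!: holomorphic_derivI[of _ "ball 0 r"])
    have "((\<lambda>w. - (w ^ q) * s) has_field_derivative - (of_nat q * w ^ (q - 1)) * s) (at w)"
      by (auto intro!: derivative_eq_intros)
    from DERIV_chain2[where g = "\<lambda>w. - (w ^ q) * s" and x = w, OF D this]
    have "((\<lambda>w. (deriv ^^ j) f (- (w ^ q) * s)) has_field_derivative
        (deriv ^^ Suc j) f (- (w ^ q) * s) * (- (of_nat q * w ^ (q - 1)) * s)) (at w)" .
    moreover have "((\<lambda>w. w powi p) has_field_derivative of_int p * w powi (p - 1)) (at w)"
      using that by (auto intro!: derivative_eq_intros)
    ultimately have "((\<lambda>w. c * s ^ i * (w powi p * (deriv ^^ j) f (- (w ^ q) * s))) has_field_derivative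
        c * s ^ i * (w powi p * ((deriv ^^ Suc j) f (- (w ^ q) * s) * (- (of_nat q * w ^ (q - 1)) * s)) +
        of_int p * w powi (p - 1) * (deriv ^^ j) f (- (w ^ q) * s))) (at w)"
      by (intro DERIV_cmult DERIV_mult')
    moreover have "w powi (p + int (q - 1)) = w powi p * w ^ (q - 1)"
      using that by (simp add: power_int_add)
    ultimately show ?thesis by (simp add: algebra_simps)
  qed
  ultimately show ?case by (intro bexI[of _ ?F'] allI impI)
next
  case (add F G)
  then obtain F' G' where "F' \<in> euler_terms q f" "G' \<in> euler_terms q f"
    "\<forall>s w. norm s < r / 2 ^ q \<longrightarrow> norm w < 2 \<longrightarrow> w \<noteq> 0 \<longrightarrow> (F s has_field_derivative F' s w) (at w)"
    "\<forall>s w. norm s < r / 2 ^ q \<longrightarrow> norm w < 2 \<longrightarrow> w \<noteq> 0 \<longrightarrow> (G s has_field_derivative G' s w) (at w)"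
    by blast
  thus ?case
    by (intro bexI[of _ "\<lambda>s w. F' s w + G' s w"] allI impI DERIV_add euler_terms.add) auto
qed

lemma euler_terms_holomorphic:
  assumes f: "f holomorphic_on ball 0 r" and F: "F \<in> euler_terms q f" and r: "r > 0"
  shows "(\<lambda>s. F s 1) holomorphic_on ball 0 (r / 2 ^ q)"
  using F
proof induction
  case (monomial c i p j)
  have sub: "uminus ` ball 0 (r / 2 ^ q) \<subseteq> ball (0 :: complex) r"
  proof -
    have "r / 2 ^ q \<le> r" using r by (simp add: field_simps)
    thus ?thesis by auto
  qed
  have "((deriv ^^ j) f \<circ> uminus) holomorphic_on ball 0 (r / 2 ^ q)"
    by (intro holomorphic_on_compose_gen[where t = "ball 0 r"] holomorphic_higher_deriv f sub holomorphic_intros) auto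
  thus ?case by (auto simp: o_def intro!: holomorphic_intros)
next
  case (add F G)
  thus ?case by (intro holomorphic_intros)
qed

text \<open>Needed for the identity theorem in s: each w-derivative agrees on a whole punctured disc
  with one member of \<open>euler_terms\<close>, whose value at w = 1 is holomorphic in s.\<close>

lemma higher_deriv_scaled_holomorphic:
  fixes e :: "complex \<Rightarrow> complex"
  assumes e: "e holomorphic_on ball 0 r" and r: "r > 0"
  shows "(\<lambda>s. (deriv ^^ n) (\<lambda>w. w powi p * e (- (w ^ q) * s)) 1) holomorphic_on ball 0 (r / 2 ^ q)"
proof -
  have "\<exists>F\<in>euler_terms q e. \<forall>s w. norm s < r / 2 ^ q \<longrightarrow> norm w < 2 \<longrightarrow> w \<noteq> 0 \<longrightarrow>
     (deriv ^^ n) (\<lambda>w. w powi p * e (- (w ^ q) * s)) w = F s w"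
  proof (induction n)
    case 0
    show ?case
      by (rule bexI[OF _ euler_terms.monomial[where c = 1 and i = 0 and p = p and j = 0]]) auto
  next
    case (Suc n)
    then obtain F where F: "F \<in> euler_terms q e"
      "\<And>s w. norm s < r / 2 ^ q \<Longrightarrow> norm w < 2 \<Longrightarrow> w \<noteq> 0 \<Longrightarrow>
         (deriv ^^ n) (\<lambda>w. w powi p * e (- (w ^ q) * s)) w = F s w" by blast
    obtain F' where F': "F' \<in> euler_terms q e"
      "\<And>s w. norm s < r / 2 ^ q \<Longrightarrow> norm w < 2 \<Longrightarrow> w \<noteq> 0 \<Longrightarrow> (F s has_field_derivative F' s w) (at w)"
      using euler_terms_deriv[OF e F(1)] by blast
    have "(deriv ^^ Suc n) (\<lambda>w. w powi p * e (- (w ^ q) * s)) w = F' s w"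
      if "norm s < r / 2 ^ q" "norm w < 2" "w \<noteq> 0" for s w
    proof -
      have "eventually (\<lambda>w. w \<in> ball 0 2 - {0}) (nhds w)"
        using that by (intro eventually_nhds_in_open) auto
      hence "eventually (\<lambda>w. (deriv ^^ n) (\<lambda>w. w powi p * e (- (w ^ q) * s)) w = F s w) (nhds w)"
        by eventually_elim (use F(2) that in auto)
      hence "deriv ((deriv ^^ n) (\<lambda>w. w powi p * e (- (w ^ q) * s))) w = deriv (F s) w"
        by (rule deriv_cong_ev) simp
      thus ?thesis using DERIV_imp_deriv[OF F'(2)[OF that]] by simp
    qed
    thus ?case using F'(1) by blast
  qed
  then obtain F where F: "F \<in> euler_terms q e"
    "\<And>s w. norm s < r / 2 ^ q \<Longrightarrow> norm w < 2 \<Longrightarrow> w \<noteq> 0 \<Longrightarrow>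
     (deriv ^^ n) (\<lambda>w. w powi p * e (- (w ^ q) * s)) w = F s w" by blast
  have "(\<lambda>s. F s 1) holomorphic_on ball 0 (r / 2 ^ q)"
    by (rule euler_terms_holomorphic[OF e F(1) r])
  thus ?thesis by (rule holomorphic_transform) (use F(2) in auto)
qed

section \<open>Coefficients of the logarithm of a power series\<close>

lemma fps_power_nth_holomorphic:
  fixes F :: "complex \<Rightarrow> complex fps"
  assumes "\<And>n. n \<le> N \<Longrightarrow> (\<lambda>s. fps_nth (F s) n) holomorphic_on A" "n \<le> N"
  shows "(\<lambda>s. fps_nth (F s ^ i) n) holomorphic_on A"
  using assms(2)
proof (induction i arbitrary: n)
  case (Suc i)
  thus ?case by (auto simp: fps_mult_nth intro!: holomorphic_intros assms(1))
qed auto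

text \<open>Coefficient N of the logarithm is a finite expression in the coefficients up to N, so
  only finitely many z n must share the domain A. A positive real part keeps z 0 nonzero and off the
  branch cut of \<open>Ln\<close>.\<close>

lemma fps_log_nth_holomorphic:
  fixes z :: "nat \<Rightarrow> complex \<Rightarrow> complex"
  assumes z: "\<And>n. n \<le> N \<Longrightarrow> z n holomorphic_on A" and pos: "\<And>s. s \<in> A \<Longrightarrow> Re (z 0 s) > 0"
  shows "(\<lambda>s. fps_nth (fps_log (Abs_fps (\<lambda>n. z n s))) N) holomorphic_on A"
proof -
  have nz: "z 0 s \<noteq> 0" if "s \<in> A" for s using pos[OF that] by auto
  have nR: "z 0 s \<notin> \<real>\<^sub>\<le>\<^sub>0" if "s \<in> A" for s using pos[OF that] by (auto simp: complex_nonpos_Reals_iff)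
  define F where "F s = fps_const (1 / z 0 s) * Abs_fps (\<lambda>n. z n s) - 1" for s
  have "(\<lambda>s. fps_nth (F s) n) holomorphic_on A" if "n \<le> N" for n
  proof -
    have "fps_nth (F s) n = 1 / z 0 s * z n s - (if n = 0 then 1 else 0)" for s
      by (simp add: F_def)
    thus ?thesis using that nz by (auto simp only: intro!: holomorphic_intros z)
  qed
  hence "(\<lambda>s. fps_nth (F s ^ i) N) holomorphic_on A" for i by (rule fps_power_nth_holomorphic) auto
  moreover have "(\<lambda>s. fps_nth (fps_const (Ln (z 0 s))) N) holomorphic_on A"
    using nR by (cases N) (auto intro!: holomorphic_intros z)
  ultimately show ?thesis
    unfolding fps_log_def fps_compose_nth fps_add_nth F_def
    by (auto simp: fps_compose_nth intro!: holomorphic_intros)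
qed

lemma fps_power_nth_cong:
  assumes "\<And>i. i \<le> n \<Longrightarrow> fps_nth F i = fps_nth G i"
  shows "fps_nth (F ^ j) n = fps_nth (G ^ j) n"
  using assms
proof (induction j arbitrary: n)
  case (Suc j)
  have "fps_nth (F ^ j) i = fps_nth (G ^ j) i" if "i \<le> n" for i
    using that by (intro Suc.IH Suc.prems) auto
  thus ?case using Suc.prems by (auto simp: fps_mult_nth intro!: sum.cong)
qed auto

text \<open>Allows a truncation of the series to be exchanged for the full series.\<close>

lemma fps_log_nth_cong:
  assumes "\<And>i. i \<le> n \<Longrightarrow> fps_nth F i = fps_nth G i"
  shows "fps_nth (fps_log F) n = fps_nth (fps_log G) n"
proof -
  have "fps_nth ((fps_const (1 / fps_nth F 0) * F - 1) ^ i) n =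
      fps_nth ((fps_const (1 / fps_nth G 0) * G - 1) ^ i) n" for i
    using assms by (intro fps_power_nth_cong) auto
  thus ?thesis using assms[of 0] by (simp add: fps_log_def fps_compose_nth)
qed

lemma has_fps_expansion_Ln_1_plus: "(\<lambda>x. Ln (1 + x)) has_fps_expansion fps_ln 1"
proof (rule has_fps_expansionI)
  have "eventually (\<lambda>x::complex. x \<in> ball 0 1) (nhds 0)" by (intro eventually_nhds_in_open) auto
  thus "eventually (\<lambda>x. (\<lambda>n. fps_nth (fps_ln 1) n * x ^ n) sums Ln (1 + x)) (nhds 0)"
  proof eventually_elim
    case (elim x)
    \<comment> \<open>At n = 0 the right-hand side divides by zero and so equals 0, the constant
      coefficient of the series.\<close>
    have "fps_nth (fps_ln 1) n = (- 1) ^ Suc n / (of_nat n :: complex)" for n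
      by (cases n) (auto simp: fps_ln_def)
    thus ?case using Ln_series[of x] elim by simp
  qed
qed

text \<open>Writing P = c (1 + w), the logarithm splits without a multiple of 2 pi i because c is a
  positive real.\<close>

lemma has_fps_expansion_Ln:
  assumes P: "P has_fps_expansion F" and c: "fps_nth F 0 = complex_of_real c" "c > 0"
  shows "(\<lambda>x. Ln (P x)) has_fps_expansion fps_log F"
proof -
  define w where "w x = 1 / of_real c * P x - 1" for x
  have w: "w has_fps_expansion fps_const (1 / fps_nth F 0) * F - 1"
    unfolding w_def c(1) by (intro fps_expansion_intros P)
  have "((\<lambda>x. Ln (1 + x)) \<circ> w) has_fps_expansion (fps_ln 1 oo (fps_const (1 / fps_nth F 0) * F - 1))"
    by (intro has_fps_expansion_compose has_fps_expansion_Ln_1_plus w) (use c in auto)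
  hence *: "(\<lambda>x. Ln (fps_nth F 0) + Ln (1 + w x)) has_fps_expansion fps_log F"
    unfolding fps_log_def o_def by (intro fps_expansion_intros)
  have "(P \<longlongrightarrow> of_real c) (nhds 0)" using has_fps_expansion_imp_tendsto_0[OF P] c by simp
  hence "eventually (\<lambda>x. P x \<noteq> 0) (nhds 0)"
    by (rule tendsto_imp_eventually_ne) (use c in auto)
  hence "eventually (\<lambda>x. Ln (fps_nth F 0) + Ln (1 + w x) = Ln (P x)) (nhds 0)"
  proof eventually_elim
    case (elim x)
    have "Ln (of_real c * (P x / of_real c)) = of_real (ln c) + Ln (P x / of_real c)"
      using elim c by (subst Ln_times_of_real) (auto simp: Ln_of_real)
    thus ?case using c by (simp add: w_def Ln_of_real)
  qed
  thus ?thesis by (rule has_fps_expansion_cong[THEN iffD1, OF _ refl *])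
qed

section \<open>Asymptotic expansions\<close>

text \<open>Baire: the closed sets where the bound holds with constant and threshold \<open>n\<close> cover the interval.\<close>

lemma pointwise_bigo_imp_uniform_on_subinterval:
  fixes r :: "nat \<Rightarrow> real \<Rightarrow> 'a::real_normed_vector"
  assumes ab: "a < b"
    and cont: "\<And>k. k \<ge> K \<Longrightarrow> continuous_on {a..b} (r k)"
    and pw: "\<And>t. t \<in> {a..b} \<Longrightarrow> \<exists>C. eventually (\<lambda>k. norm (r k t) \<le> C * u k) sequentially"
    and u: "\<And>k. u k \<ge> 0"
  shows "\<exists>a' b' C N. a \<le> a' \<and> a' < b' \<and> b' \<le> b \<and> (\<forall>k\<ge>N. \<forall>t\<in>{a'..b'}. norm (r k t) \<le> C * u k)"
proof -
  \<comment> \<open>The threshold \<open>max n K\<close> admits only those k for which r k is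
    continuous, so that A n is closed.\<close>
  define A where "A n = {t\<in>{a..b}. \<forall>k\<ge>max n K. norm (r k t) \<le> real n * u k}" for n
  have clo: "closed (A n)" for n
  proof -
    have "A n = {a..b} \<inter> (\<Inter>k\<in>{max n K..}. {t\<in>{a..b}. norm (r k t) \<le> real n * u k})"
      by (auto simp: A_def)
    moreover have "closed {t\<in>{a..b}. norm (r k t) \<le> real n * u k}" if "k \<ge> K" for k
      by (intro continuous_on_closed_Collect_le continuous_intros cont that closed_atLeastAtMost)
    ultimately show ?thesis by (auto intro!: closed_Int closed_INT)
  qed
  have cover: "{a..b} \<subseteq> (\<Union>n. A n)"
  proof
    fix t assume t: "t \<in> {a..b}"
    then obtain C N where C: "\<And>k. k \<ge> N \<Longrightarrow> norm (r k t) \<le> C * u k"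
      using pw unfolding eventually_sequentially by blast
    define n where "n = max N (nat \<lceil>C\<rceil>)"
    have "C \<le> real n" unfolding n_def by linarith
    hence "norm (r k t) \<le> real n * u k" if "k \<ge> max n K" for k
      using C[of k] that u[of k] by (auto simp: n_def intro: order.trans mult_right_mono)
    hence "t \<in> A n" using t by (auto simp: A_def)
    thus "t \<in> (\<Union>n. A n)" by blast
  qed
  have "\<exists>n. interior (A n) \<noteq> {}"
  proof (rule ccontr)
    assume no: "\<not> ?thesis"
    have "euclidean interior_of \<Union> (range A) = {}"
      by (rule Baire_category_alt)
         (use clo no in \<open>auto simp: completely_metrizable_space_euclidean\<close>)
    moreover have "{a<..<b} \<subseteq> interior (\<Union> (range A))"
      using cover by (intro interior_maximal) auto
    ultimately show False using ab by auto
  qed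
  then obtain n t where t: "t \<in> interior (A n)" by blast
  then obtain e where e: "e > 0" "cball t e \<subseteq> A n"
    by (meson interior_subset open_contains_cball open_interior subset_trans)
  have sub: "{t - e..t + e} \<subseteq> A n" using e by (auto simp: cball_eq_atLeastAtMost)
  have "t - e \<in> A n" "t + e \<in> A n" using sub e by auto
  hence "a \<le> t - e" "t - e < t + e" "t + e \<le> b" using e by (auto simp: A_def)
  moreover have "\<forall>k\<ge>max n K. \<forall>t\<in>{t - e..t + e}. norm (r k t) \<le> real n * u k"
    using sub unfolding A_def by blast
  ultimately show ?thesis by blast
qed

section \<open>From bounds along 1/k to identities between coefficients\<close>

text \<open>If a coefficient below N were nonzero, f(1/k) would be asymptotic to a nonzero multiple
  of (1/k)^d, with d < N the subdegree, contradicting the bound.\<close>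

lemma has_fps_expansion_bigo_imp_nth_eq_0:
  fixes f :: "complex \<Rightarrow> complex"
  assumes f: "f has_fps_expansion F"
    and bigo: "(\<lambda>k. f (1 / of_nat k)) \<in> O(\<lambda>k. (1 / of_nat k) ^ N)" and j: "j < N"
  shows "fps_nth F j = 0"
proof (rule ccontr)
  assume nz: "fps_nth F j \<noteq> 0"
  define d where "d = subdegree F"
  have d: "d < N" using subdegree_leI[OF nz] j by (simp add: d_def)
  have F: "fps_nth F d \<noteq> 0" using nz by (auto simp: d_def)
  have lim: "filterlim (\<lambda>k. 1 / of_nat k :: complex) (nhds 0) sequentially"
    by (rule lim_1_over_n)
  have "(\<lambda>k. f (1 / of_nat k)) \<sim>[sequentially] (\<lambda>k. fps_nth F d * (1 / of_nat k) ^ d)"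
    unfolding d_def by (rule asymp_equiv_compose'[OF has_fps_expansion_imp_asymp_equiv_0[OF f] lim])
  hence "(\<lambda>k. fps_nth F d * (1 / of_nat k) ^ d) \<in> O(\<lambda>k. f (1 / of_nat k))"
    by (rule asymp_equiv_imp_bigo[OF asymp_equiv_symI])
  hence "(\<lambda>k. (1 / of_nat k) ^ d) \<in> O(\<lambda>k. f (1 / of_nat k))"
    using F by simp
  also note bigo
  also have "(\<lambda>k. (1 / of_nat k) ^ N) \<in> o(\<lambda>k. (1 / of_nat k :: complex) ^ d)"
  proof (rule smalloI_tendsto)
    have "(\<lambda>k. (1 / of_nat k :: complex) ^ (N - d)) \<longlonglongrightarrow> 0 ^ (N - d)"
      by (intro tendsto_power lim)
    hence "(\<lambda>k. (1 / of_nat k :: complex) ^ (N - d)) \<longlonglongrightarrow> 0" using d by (simp add: zero_power)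
    moreover have "eventually (\<lambda>k. (1 / of_nat k :: complex) ^ (N - d) = (1 / of_nat k) ^ N / (1 / of_nat k) ^ d) sequentially"
      using eventually_gt_at_top[of 0] by eventually_elim (use d in \<open>simp add: power_diff\<close>)
    ultimately show "(\<lambda>k. (1 / of_nat k :: complex) ^ N / (1 / of_nat k) ^ d) \<longlonglongrightarrow> 0"
      using tendsto_cong by force
    show "eventually (\<lambda>k. (1 / of_nat k :: complex) ^ d \<noteq> 0) sequentially"
      using eventually_gt_at_top[of 0] by eventually_elim auto
  qed
  finally have "eventually (\<lambda>k. (1 / of_nat k :: complex) ^ d = 0) sequentially"
    by (simp add: landau_o.small_refl_iff)
  moreover have "eventually (\<lambda>k. (1 / of_nat k :: complex) ^ d \<noteq> 0) sequentially"
      using eventually_gt_at_top[of 0] by eventually_elim auto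
  ultimately have "eventually (\<lambda>k::nat. False) sequentially" by eventually_elim auto
  thus False by simp
qed

lemma bigo_inverse_power_tendsto_0:
  fixes f :: "nat \<Rightarrow> complex"
  assumes "f \<in> O(\<lambda>k. (1 / of_nat k) ^ (2 * m + 2))"
  shows "f \<longlonglongrightarrow> 0"
proof -
  have "(\<lambda>k. (1 / of_nat k :: complex) ^ (2 * m + 2)) \<longlonglongrightarrow> 0"
    using tendsto_power[OF lim_1_over_n, of "2 * m + 2"] by simp
  hence "(\<lambda>k. (1 / of_nat k :: complex) ^ (2 * m + 2)) \<in> o(\<lambda>_. 1)"
    by (intro smalloI_tendsto) auto
  from smalloD_tendsto[OF landau_o.big_small_trans[OF assms this]] show ?thesis by simp
qed

text \<open>On this ball the modulus is at least c/2, so the derivative of \<open>Ln\<close> is at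
  most 2/c. It transfers the error of an approximation to its logarithm.\<close>

lemma norm_Ln_diff_le:
  assumes c: "c > 0" and z: "z \<in> ball (complex_of_real c) (c / 2)" "w \<in> ball (complex_of_real c) (c / 2)"
  shows "norm (Ln z - Ln w) \<le> 2 / c * norm (z - w)"
proof (rule field_differentiable_bound[OF convex_ball _ _ z])
  fix x assume x: "x \<in> ball (complex_of_real c) (c / 2)"
  have "c - Re x \<le> norm (of_real c - x)" using complex_Re_le_cmod[of "of_real c - x"] by simp
  hence re: "Re x > c / 2" using x by (simp add: dist_norm)
  hence "x \<notin> \<real>\<^sub>\<le>\<^sub>0" using c by (auto simp: complex_nonpos_Reals_iff)
  thus "(Ln has_field_derivative inverse x) (at x within ball (complex_of_real c) (c / 2))"
    by (rule has_field_derivative_at_within[OF has_field_derivative_Ln])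
  have "norm x \<ge> c / 2" using re complex_Re_le_cmod[of x] by linarith
  hence "inverse (norm x) \<le> inverse (c / 2)" using c by (intro le_imp_inverse_le) auto
  thus "norm (inverse x) \<le> 2 / c" by (simp add: norm_inverse)
qed

text \<open>Replacing a k by its truncated expansion P(1/k^2) costs only an admissible error, and
  turns the bound into one for a function K, analytic at 0, evaluated at 1/k. Its coefficients below
  x^(2m+2) vanish; the one at x^(2G+2) is the claim.\<close>

lemma second_difference_expansion_coefficients:
  fixes \<phi> :: "nat \<Rightarrow> complex \<Rightarrow> complex" and z :: "nat \<Rightarrow> complex" and a :: "nat \<Rightarrow> real"
  assumes phi: "\<And>g. g \<le> m \<Longrightarrow> \<phi> g analytic_on {1}" and z0: "z 0 = of_real c" and c: "c > 0"
    and a: "(\<lambda>k. of_real (a k) - (\<Sum>n\<le>m. z n * (1 / of_nat k) ^ (2 * n))) \<in> O(\<lambda>k. (1 / of_nat k) ^ (2 * m + 2))"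
    and diff: "(\<lambda>k. (\<Sum>g\<le>m. (1 / of_nat k) ^ (2 * g) * (\<phi> g (1 + 1 / of_nat k) + \<phi> g (1 - 1 / of_nat k) - 2 * \<phi> g 1))
        - (1 / of_nat k)\<^sup>2 * of_real (ln (a k))) \<in> O(\<lambda>k. (1 / of_nat k) ^ (2 * m + 2))"
    and G: "G < m"
  shows "(\<Sum>n\<le>G. 2 / fact (2 * n + 2) * (deriv ^^ (2 * n + 2)) (\<phi> (G - n)) 1) =
    fps_nth (fps_log (Abs_fps z)) G"
proof -
  define P where "P y = (\<Sum>n\<le>m. z n * y ^ n)" for y
  define FP where "FP = (\<Sum>n\<le>m. fps_const (z n) * fps_X ^ n)"
  define A where "A g = fps_expansion (\<phi> g) 1" for g
  define B where "B g = A g + (A g oo (fps_const (-1) * fps_X)) - fps_const (2 * \<phi> g 1)" for g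
  define K where "K x = (\<Sum>g\<le>m. x ^ (2 * g) * (\<phi> g (1 + x) + \<phi> g (1 - x) - 2 * \<phi> g 1)) - x\<^sup>2 * Ln (P (x\<^sup>2))" for x
  define FK where "FK = (\<Sum>g\<le>m. fps_X ^ (2 * g) * B g) - fps_X\<^sup>2 * (fps_log FP oo fps_X\<^sup>2)"
  let ?x = "\<lambda>k. 1 / of_nat k :: complex"
  have lim: "?x \<longlonglongrightarrow> 0" by (rule lim_1_over_n)

  have FPn: "fps_nth FP n = z n" if "n \<le> m" for n
    using that by (simp add: FP_def fps_sum_nth if_distrib[of "\<lambda>x. _ * x"] cong: if_cong)
  have P: "P has_fps_expansion FP"
    unfolding P_def FP_def by (intro fps_expansion_intros)
  have LnP: "(\<lambda>y. Ln (P y)) has_fps_expansion fps_log FP"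
    by (rule has_fps_expansion_Ln[OF P _ c]) (simp add: FPn z0)
  have "((\<lambda>y. Ln (P y)) \<circ> (\<lambda>x. x\<^sup>2)) has_fps_expansion (fps_log FP oo fps_X\<^sup>2)"
    by (intro has_fps_expansion_compose LnP fps_expansion_intros) auto
  hence LnP2: "(\<lambda>x. Ln (P (x\<^sup>2))) has_fps_expansion (fps_log FP oo fps_X\<^sup>2)" by (simp add: o_def)
  have Ag: "(\<lambda>x. \<phi> g (1 + x)) has_fps_expansion A g" if "g \<le> m" for g
    unfolding A_def by (rule analytic_at_imp_has_fps_expansion[OF phi[OF that]])
  have Ag': "(\<lambda>x. \<phi> g (1 - x)) has_fps_expansion (A g oo (fps_const (-1) * fps_X))" if "g \<le> m" for g
  proof -
    have "((\<lambda>x. \<phi> g (1 + x)) \<circ> (\<lambda>x. -1 * x)) has_fps_expansion (A g oo (fps_const (-1) * fps_X))"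
      by (intro has_fps_expansion_compose Ag that fps_expansion_intros) auto
    thus ?thesis by (simp add: o_def)
  qed
  have K: "K has_fps_expansion FK"
    unfolding K_def FK_def B_def by (intro fps_expansion_intros Ag Ag' LnP2) auto

  have Pa: "(\<lambda>k. of_real (a k) - P ((?x k)\<^sup>2)) \<in> O(\<lambda>k. ?x k ^ (2 * m + 2))"
    using a by (simp add: P_def power_mult)
  have LP: "(\<lambda>k. of_real (ln (a k)) - Ln (P ((?x k)\<^sup>2))) \<in> O(\<lambda>k. ?x k ^ (2 * m + 2))"
  proof -
    have "(P \<longlongrightarrow> of_real c) (nhds 0)"
      using has_fps_expansion_imp_tendsto_0[OF P] by (simp add: FPn z0)
    moreover have "filterlim (\<lambda>k. (?x k)\<^sup>2) (nhds 0) sequentially"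
      using tendsto_power[OF lim, of 2] by simp
    ultimately have Plim: "(\<lambda>k. P ((?x k)\<^sup>2)) \<longlonglongrightarrow> of_real c" by (rule filterlim_compose)
    have "(\<lambda>k. of_real (a k) - P ((?x k)\<^sup>2)) \<longlonglongrightarrow> 0"
      by (rule bigo_inverse_power_tendsto_0[OF Pa])
    from tendsto_add[OF this Plim] have alim: "(\<lambda>k. complex_of_real (a k)) \<longlonglongrightarrow> of_real c" by simp
    have ev: "eventually (\<lambda>k. X k \<in> ball (complex_of_real c) (c / 2)) sequentially"
      if "X \<longlonglongrightarrow> complex_of_real c" for X
      using that c by (intro topological_tendstoD) auto
    have "eventually (\<lambda>k. norm (of_real (ln (a k)) - Ln (P ((?x k)\<^sup>2))) \<le>
        2 / c * norm (of_real (a k) - P ((?x k)\<^sup>2))) sequentially"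
      using ev[OF alim] ev[OF Plim]
    proof eventually_elim
      case (elim k)
      have "c - a k \<le> norm (complex_of_real c - of_real (a k))"
        using complex_Re_le_cmod[of "of_real c - of_real (a k)"] by simp
      hence "a k > 0" using elim(1) c by (simp add: dist_norm)
      thus ?case using norm_Ln_diff_le[OF c elim] by (simp add: Ln_of_real)
    qed
    hence "(\<lambda>k. of_real (ln (a k)) - Ln (P ((?x k)\<^sup>2))) \<in> O(\<lambda>k. of_real (a k) - P ((?x k)\<^sup>2))"
      by (rule bigoI)
    thus ?thesis using Pa by (rule landau_o.big_trans)
  qed
  have "(\<lambda>k. (?x k)\<^sup>2) \<in> O(\<lambda>_. 1 :: complex)"
    using tendsto_power[OF lim, of 2] by (intro bigoI_tendsto[where c = 0]) auto
  from landau_o.big.mult[OF this LP]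
  have "(\<lambda>k. (?x k)\<^sup>2 * (of_real (ln (a k)) - Ln (P ((?x k)\<^sup>2)))) \<in> O(\<lambda>k. ?x k ^ (2 * m + 2))" by simp
  from sum_in_bigo(1)[OF diff this]
  have "(\<lambda>k. K (?x k)) \<in> O(\<lambda>k. ?x k ^ (2 * m + 2))"
    by (simp add: K_def algebra_simps)
  hence 0: "fps_nth FK (2 * G + 2) = 0"
    by (rule has_fps_expansion_bigo_imp_nth_eq_0[OF K]) (use G in simp)

  \<comment> \<open>In phi(1+x) + phi(1-x) odd powers cancel and even ones double; subtracting 2
    phi(1) removes the constant.\<close>
  have Bn: "fps_nth (B g) i = (if i = 0 then 0 else if even i then 2 * (deriv ^^ i) (\<phi> g) 1 / fact i else 0)" for g i
    by (auto simp: B_def A_def fps_compose_linear fps_expansion_def)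
  have "fps_nth (\<Sum>g\<le>m. fps_X ^ (2 * g) * B g) (2 * G + 2) =
      (\<Sum>g\<le>m. if g \<le> G then 2 * (deriv ^^ (2 * (G - g) + 2)) (\<phi> g) 1 / fact (2 * (G - g) + 2) else 0)"
    unfolding fps_sum_nth fps_X_power_mult_nth
  proof (intro sum.cong refl)
    fix g
    \<comment> \<open>For g = G + 1 only the vanishing constant term of B g is hit; larger g start
      beyond the required power.\<close>
    consider "g \<le> G" | "g = G + 1" | "g > G + 1" by linarith
    thus "(if 2 * G + 2 < 2 * g then 0 else fps_nth (B g) (2 * G + 2 - 2 * g)) =
        (if g \<le> G then 2 * (deriv ^^ (2 * (G - g) + 2)) (\<phi> g) 1 / fact (2 * (G - g) + 2) else 0)"
    proof cases
      case 1
      hence "2 * G + 2 - 2 * g = 2 * (G - g) + 2" by simp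
      thus ?thesis using 1 unfolding Bn by auto
    qed (auto simp: Bn)
  qed
  also have "\<dots> = (\<Sum>g\<le>G. 2 * (deriv ^^ (2 * (G - g) + 2)) (\<phi> g) 1 / fact (2 * (G - g) + 2))"
    using G by (intro sum.mono_neutral_cong_right) auto
  also have "\<dots> = (\<Sum>n\<le>G. 2 / fact (2 * n + 2) * (deriv ^^ (2 * n + 2)) (\<phi> (G - n)) 1)"
    by (rule sum.reindex_bij_witness[of _ "\<lambda>n. G - n" "\<lambda>n. G - n"]) auto
  finally have 1: "fps_nth (\<Sum>g\<le>m. fps_X ^ (2 * g) * B g) (2 * G + 2) =
      (\<Sum>n\<le>G. 2 / fact (2 * n + 2) * (deriv ^^ (2 * n + 2)) (\<phi> (G - n)) 1)" .
  have "fps_nth (fps_X\<^sup>2 * (fps_log FP oo fps_X\<^sup>2)) (2 * G + 2) = fps_nth (fps_log FP) G"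
    by (simp add: fps_X_power_mult_nth fps_nth_compose_X_power)
  also have "\<dots> = fps_nth (fps_log (Abs_fps z)) G"
    using G by (intro fps_log_nth_cong) (simp add: FPn)
  finally show ?thesis using 0 1 by (simp add: FK_def)
qed

lemma analytic_imp_common_ball:
  fixes f :: "nat \<Rightarrow> complex \<Rightarrow> complex"
  assumes "\<And>i. f i analytic_on {0}"
  shows "\<exists>r>0. \<forall>i\<le>m. f i holomorphic_on ball 0 r"
proof -
  have "\<exists>r>0. f i holomorphic_on ball 0 r" for i
    using assms[of i] unfolding analytic_on_def by simp
  then obtain r where r: "\<And>i. r i > 0" "\<And>i. f i holomorphic_on ball 0 (r i)" by metis
  have "f i holomorphic_on ball 0 (Min (r ` {..m}))" if "i \<le> m" for i
    using that by (intro holomorphic_on_subset[OF r(2)] subset_ball Min_le) auto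
  moreover have "Min (r ` {..m}) > 0" using r(1) by (subst Min_gr_iff) auto
  ultimately show ?thesis by blast
qed

text \<open>Dividing by k^a leaves natural powers of 1/k, the form comparable with power series in
  1/k.\<close>

lemma has_asymp_expansion_normalized:
  assumes "has_asymp_expansion f a c"
  shows "(\<lambda>k. f k / of_nat k powi a - (\<Sum>n\<le>m. c n * (1 / of_nat k) ^ (2 * n))) \<in> O(\<lambda>k. (1 / of_nat k) ^ (2 * m + 2))"
proof -
  have pw: "(of_nat k :: complex) powi (a - 2 * int g) = of_nat k powi a * (1 / of_nat k) ^ (2 * g)" if "k > 0" for k g
  proof -
    have "(of_nat k :: complex) powi (a - 2 * int g) = of_nat k powi a / of_nat k powi (int (2 * g))"
      using that by (subst power_int_diff) auto
    thus ?thesis by (simp only: power_int_of_nat) (simp add: power_one_over divide_simps)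
  qed
  have "(\<lambda>k. (f k - (\<Sum>g\<le>m. c g * of_nat k powi (a - 2 * int g))) / of_nat k powi a) \<in>
      O(\<lambda>k. of_nat k powi (a - 2 * int (m + 1)) / of_nat k powi a)"
    using assms unfolding has_asymp_expansion_def divide_inverse by (intro landau_o.big.mult_right) blast
  hence A: "(\<lambda>k. (f k - (\<Sum>g\<le>m. c g * of_nat k powi (a - 2 * int g))) / of_nat k powi a) \<in>
      O(\<lambda>k. of_nat k powi (a - 2 * int (m + 1)) / of_nat k powi a)" .
  have ev1: "eventually (\<lambda>k. (f k - (\<Sum>g\<le>m. c g * of_nat k powi (a - 2 * int g))) / of_nat k powi a =
      f k / of_nat k powi a - (\<Sum>n\<le>m. c n * (1 / of_nat k) ^ (2 * n))) sequentially"
    using eventually_gt_at_top[of 0]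
    by eventually_elim (simp add: pw diff_divide_distrib sum_divide_distrib)
  have ev2: "eventually (\<lambda>k. of_nat k powi (a - 2 * int (m + 1)) / of_nat k powi a =
      (1 / of_nat k :: complex) ^ (2 * m + 2)) sequentially"
    using eventually_gt_at_top[of 0]
  proof eventually_elim
    case (elim k)
    thus ?case unfolding pw[OF elim] by simp
  qed
  show ?thesis
    using A unfolding landau_o.big.in_cong[OF ev1] landau_o.big.cong[OF ev2] .
qed

text \<open>With y = j/k one has k^(-2n) phi_n(y) = y^2 e_n(t_j) j^(-2n), so the j-particle
  expansion at its own time t_j becomes a statement in powers of 1/k. The times for j = k-1, k+1
  move with k but tend to -s, hence eventually lie in the interval of uniformity.\<close>

lemma second_difference_of_uniform_expansion:
  fixes f :: "nat \<Rightarrow> real \<Rightarrow> real" and e :: "nat \<Rightarrow> complex \<Rightarrow> complex" and s :: real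
  assumes s: "- s \<in> {\<alpha><..<\<beta>}"
    and unif: "\<And>k t. k \<ge> N \<Longrightarrow> t \<in> {\<alpha>..\<beta>} \<Longrightarrow>
      norm (of_real (f k t) / (of_nat k)\<^sup>2 - (\<Sum>n\<le>m. e n (of_real t) * (1 / of_nat k) ^ (2 * n)))
        \<le> C * (1 / real k) ^ (2 * m + 2)"
    and L: "\<And>k. k \<ge> 2 \<Longrightarrow> f (k + 1) (- (s * (real (k + 1) / real k) ^ q)) +
      f (k - 1) (- (s * (real (k - 1) / real k) ^ q)) - 2 * f k (- s) = L k"
  defines "\<phi> \<equiv> (\<lambda>g w. w powi (2 - 2 * int g) * e g (- (w ^ q) * of_real s))"
  shows "(\<lambda>k. (\<Sum>g\<le>m. (1 / of_nat k) ^ (2 * g) * (\<phi> g (1 + 1 / of_nat k) + \<phi> g (1 - 1 / of_nat k) - 2 * \<phi> g 1))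
        - (1 / of_nat k)\<^sup>2 * of_real (L k)) \<in> O(\<lambda>k. (1 / of_nat k) ^ (2 * m + 2))"
proof -
  define E where "E j k = (1 / of_nat k)\<^sup>2 * of_real (f j (- (s * (real j / real k) ^ q))) -
     (\<Sum>n\<le>m. (1 / of_nat k) ^ (2 * n) * \<phi> n (of_nat j / of_nat k))" for j k :: nat
  have C: "C \<ge> 0"
  proof -
    define p where "p = (1 / real (Suc N)) ^ (2 * m + 2)"
    have "0 \<le> C * p"
      unfolding p_def using s by (intro order.trans[OF norm_ge_zero unif[of "Suc N" "- s"]]) auto
    moreover have "p > 0" by (simp add: p_def)
    ultimately show ?thesis by (simp add: zero_le_mult_iff)
  qed
  have E: "norm (E j k) \<le> C * ((real j / real k)\<^sup>2 * (1 / real j) ^ (2 * m + 2))"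
    if "j \<ge> 1" "k \<ge> 1" "j \<ge> N" "- (s * (real j / real k) ^ q) \<in> {\<alpha>..\<beta>}" for j k
  proof -
    define y :: complex where "y = of_nat j / of_nat k"
    define t where "t = - (s * (real j / real k) ^ q)"
    have y: "y \<noteq> 0" using that by (simp add: y_def)
    have t: "complex_of_real t = - (y ^ q) * of_real s" by (simp add: t_def y_def)
    have summand: "(1 / of_nat k) ^ (2 * n) * \<phi> n y = y\<^sup>2 * (e n (of_real t) * (1 / of_nat j) ^ (2 * n))" for n
    proof -
      have "y powi (2 - 2 * int n) = y\<^sup>2 / y powi (int (2 * n))"
        using y by (subst power_int_diff) auto
      also have "\<dots> = y\<^sup>2 / y ^ (2 * n)" by (simp only: power_int_of_nat)
      finally have "(1 / of_nat k) ^ (2 * n) * y powi (2 - 2 * int n) = y\<^sup>2 * (1 / of_nat j) ^ (2 * n)"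
        using that y by (simp add: y_def power_divide field_simps)
      thus ?thesis unfolding \<phi>_def t by (simp add: algebra_simps)
    qed
    have "E j k = y\<^sup>2 * (of_real (f j t) / (of_nat j)\<^sup>2 - (\<Sum>n\<le>m. e n (of_real t) * (1 / of_nat j) ^ (2 * n)))"
      unfolding E_def y_def[symmetric] t_def[symmetric] summand sum_distrib_left[symmetric] right_diff_distrib
      using that by (simp add: y_def power_divide)
    hence "norm (E j k) = (real j / real k)\<^sup>2 *
        norm (of_real (f j t) / (of_nat j)\<^sup>2 - (\<Sum>n\<le>m. e n (of_real t) * (1 / of_nat j) ^ (2 * n)))"
      by (simp add: norm_mult norm_power norm_divide y_def)
    also have "\<dots> \<le> (real j / real k)\<^sup>2 * (C * (1 / real j) ^ (2 * m + 2))"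
      using that by (intro mult_left_mono unif) (auto simp: t_def)
    finally show ?thesis by (simp add: mult_ac)
  qed
  have lim: "(\<lambda>k. - (s * (1 + c * (1 / real k)) ^ q)) \<longlonglongrightarrow> - s" for c
    by (auto intro!: tendsto_eq_intros lim_1_over_n)
  have ev: "eventually (\<lambda>k. - (s * (1 + c * (1 / real k)) ^ q) \<in> {\<alpha><..<\<beta>}) sequentially" for c
    using topological_tendstoD[OF lim[of c], of "{\<alpha><..<\<beta>}"] s by auto
  \<comment> \<open>The constant collects 2 from j = k, 4 from ((k+1)/k)^2 <= 4, and 2^(2m+2) from
    1/(k-1) <= 2/k.\<close>
  have "eventually (\<lambda>k. norm ((\<Sum>g\<le>m. (1 / of_nat k) ^ (2 * g) * (\<phi> g (1 + 1 / of_nat k) + \<phi> g (1 - 1 / of_nat k) - 2 * \<phi> g 1))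
        - (1 / of_nat k)\<^sup>2 * of_real (L k)) \<le> C * (6 + 2 ^ (2 * m + 2)) * norm ((1 / of_nat k :: complex) ^ (2 * m + 2))) sequentially"
    using ev[of 1] ev[of "-1"] eventually_ge_at_top[of "N + 2"]
  proof eventually_elim
    case (elim k)
    have k: "k \<ge> 2" "k - 1 \<ge> 1" "k - 1 \<ge> N" using elim(3) by auto
    have yr: "real (k + 1) / real k = 1 + 1 * (1 / real k)" "real (k - 1) / real k = 1 + - 1 * (1 / real k)"
      using k by (auto simp: field_simps of_nat_diff)
    have yc: "of_nat (k + 1) / of_nat k = (1 + 1 / of_nat k :: complex)"
      "of_nat (k - 1) / of_nat k = (1 - 1 / of_nat k :: complex)" "of_nat k / of_nat k = (1::complex)"
      using k by (auto simp: field_simps of_nat_diff)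
    define X where "X = (1 / real k) ^ (2 * m + 2)"
    have X: "X \<ge> 0" by (simp add: X_def)
    have split: "(\<Sum>g\<le>m. (1 / of_nat k) ^ (2 * g) * (\<phi> g (1 + 1 / of_nat k) + \<phi> g (1 - 1 / of_nat k) - 2 * \<phi> g 1))
        - (1 / of_nat k)\<^sup>2 * of_real (L k) = 2 * E k k - E (k + 1) k - E (k - 1) k"
    proof -
      have "f k (- (s * (real k / real k) ^ q)) = f k (- s)" using k by simp
      thus ?thesis unfolding E_def yc L[OF k(1), symmetric]
        by (simp add: algebra_simps sum.distrib sum_subtractf sum_distrib_left)
    qed
    have 1: "norm (E k k) \<le> C * X"
      using E[of k k] k s by (simp add: X_def)
    have "norm (E (k + 1) k) \<le> C * ((real (k + 1) / real k)\<^sup>2 * (1 / real (k + 1)) ^ (2 * m + 2))"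
      using elim(1) k unfolding yr[symmetric] by (intro E) auto
    also have "\<dots> \<le> C * (2\<^sup>2 * X)"
      unfolding X_def using k C by (intro mult_left_mono mult_mono power_mono) (auto simp: field_simps)
    finally have 2: "norm (E (k + 1) k) \<le> C * (4 * X)" by simp
    have "norm (E (k - 1) k) \<le> C * ((real (k - 1) / real k)\<^sup>2 * (1 / real (k - 1)) ^ (2 * m + 2))"
      using elim(2) k unfolding yr[symmetric] by (intro E) auto
    also have "\<dots> \<le> C * (1\<^sup>2 * (2 * (1 / real k)) ^ (2 * m + 2))"
    proof -
      have "real (k - 1) / real k \<le> 1" "1 / real (k - 1) \<le> 2 * (1 / real k)"
        using k by (auto simp: field_simps of_nat_diff)
      thus ?thesis using C by (intro mult_left_mono mult_mono power_mono) auto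
    qed
    also have "\<dots> = C * (2 ^ (2 * m + 2) * X)" by (simp only: X_def power_mult_distrib power_one mult_1)
    finally have 3: "norm (E (k - 1) k) \<le> C * (2 ^ (2 * m + 2) * X)" .
    have "norm (2 * E k k - E (k + 1) k - E (k - 1) k) \<le> 2 * norm (E k k) + norm (E (k + 1) k) + norm (E (k - 1) k)"
      using norm_triangle_ineq4[of "2 * E k k - E (k + 1) k" "E (k - 1) k"]
        norm_triangle_ineq4[of "2 * E k k" "E (k + 1) k"] by (simp add: norm_mult)
    also have "\<dots> \<le> C * (6 + 2 ^ (2 * m + 2)) * X" using 1 2 3 by (simp only: distrib_left distrib_right mult.assoc)
    also have "X = norm ((1 / of_nat k :: complex) ^ (2 * m + 2))"
      by (simp only: X_def norm_power norm_divide norm_one norm_of_nat)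
    finally show ?case unfolding split .
  qed
  thus ?thesis by (rule bigoI)
qed

section \<open>The recursion\<close>

theorem theorem2p4:
  fixes \<nu> :: nat
    and e z :: "nat \<Rightarrow> complex \<Rightarrow> complex"
    and b :: "nat \<Rightarrow> real \<Rightarrow> real"
  assumes nu: "\<nu> \<ge> 2"
    and e_analytic: "\<And>g. e g analytic_on {0}"
    and e_expansion: "\<And>t :: real. t \<ge> 0 \<Longrightarrow>
          has_asymp_expansion
            (\<lambda>k. of_real (ln (partition_function \<nu> k t / partition_function \<nu> k 0)))
            2 (\<lambda>g. e g (of_real t))"
    and b_recurrence: "\<And>\<xi> :: real. \<xi> \<le> 0 \<Longrightarrow> recurrence_coeffs (even_weight \<nu> \<xi>) (\<lambda>k. b k \<xi>)"
    and z_analytic: "\<And>g. z g analytic_on {0}"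
    and z_expansion: "\<And>s :: real. s \<le> 0 \<Longrightarrow>
          has_asymp_expansion
            (\<lambda>k. of_real ((b k (s / (2 * real k ^ (\<nu> - 1))))^2))
            1 (\<lambda>g. z g (of_real s))"
  shows "\<forall>g. \<forall>\<^sub>F s in nhds (0 :: complex).
          (deriv ^^ 2) (\<lambda>w. w powi (2 - 2 * int g) * e g (- (w ^ (\<nu> - 1)) * s)) 1 =
          - (\<Sum>n=1..g. 2 / fact (2 * n + 2) *
               (deriv ^^ (2 * n + 2))
                 (\<lambda>w. w powi (2 - 2 * int (g - n)) * e (g - n) (- (w ^ (\<nu> - 1)) * s)) 1)
          + fps_log (Abs_fps (\<lambda>n. z n s)) $ g"
proof
  fix g :: nat
  define q where "q = \<nu> - 1"
  \<comment> \<open>The identity for k^(-2g) is read off at x^(2g+2), which must lie below the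
    truncation error x^(2m+2).\<close>
  define m where "m = g + 1"
  define f where "f k t = ln (partition_function \<nu> k t / partition_function \<nu> k 0)" for k t
  define \<phi> where "\<phi> s h w = w powi (2 - 2 * int h) * e h (- (w ^ q) * s)" for s h w
  define a where "a s k = (b k (s / (2 * real k ^ q)))\<^sup>2 / real k" for s k
  have nu1: "\<nu> \<ge> 1" using nu by simp
  have orth: "\<exists>p. orthonormal_polys (even_weight \<nu> \<xi>) p" if "\<xi> \<le> 0" for \<xi>
    using b_recurrence[OF that] unfolding recurrence_coeffs_def by blast

  have a_asymp: "(\<lambda>k. of_real (a s k) - (\<Sum>n\<le>N. z n (of_real s) * (1 / of_nat k) ^ (2 * n)))
      \<in> O(\<lambda>k. (1 / of_nat k) ^ (2 * N + 2))" if "s \<le> 0" for s N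
    using has_asymp_expansion_normalized[OF z_expansion[OF that], of N] by (simp add: a_def q_def)
  have a_lim: "(\<lambda>k. complex_of_real (a s k)) \<longlonglongrightarrow> z 0 (of_real s)" if "s \<le> 0" for s
    using bigo_inverse_power_tendsto_0[OF a_asymp[OF that, of 0]] by (simp add: LIM_zero_iff)
  \<comment> \<open>At s = 0 the weight is Gaussian, so the normalised squared coefficients are
    exactly 1 for k >= 1. Hence z 0 has positive real part near 0 and its logarithm is defined
    there.\<close>
  have z0: "z 0 0 = 1"
  proof -
    have W: "recurrence_coeffs (\<lambda>x. exp (- (1/2) * x^2)) (\<lambda>k. b k 0)"
      using b_recurrence[of 0] by (simp add: even_weight_0)
    have "eventually (\<lambda>k. complex_of_real (a 0 k) = 1) sequentially"
      using eventually_ge_at_top[of 1]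
      by eventually_elim (simp add: a_def gaussian_recurrence_coeffs[OF W])
    hence "(\<lambda>k. complex_of_real (a 0 k)) \<longlonglongrightarrow> 1" by (rule tendsto_eventually)
    with a_lim[of 0] show ?thesis using LIMSEQ_unique by fastforce
  qed

  obtain r where r: "r > 0" "\<And>i. i \<le> m \<Longrightarrow> e i holomorphic_on ball 0 r"
    "\<And>i. i \<le> m \<Longrightarrow> z i holomorphic_on ball 0 r" "\<And>s. s \<in> ball 0 r \<Longrightarrow> Re (z 0 s) > 0"
  proof -
    obtain r1 where r1: "r1 > 0" "\<forall>i\<le>m. e i holomorphic_on ball 0 r1"
      using analytic_imp_common_ball[of e m] e_analytic by blast
    obtain r2 where r2: "r2 > 0" "\<forall>i\<le>m. z i holomorphic_on ball 0 r2"
      using analytic_imp_common_ball[of z m] z_analytic by blast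
    have "isCont (z 0) 0" using z_analytic[of 0] by (rule analytic_at_imp_isCont)
    hence "(z 0 \<longlongrightarrow> z 0 0) (nhds 0)"
      by (simp add: isCont_def tendsto_at_iff_tendsto_nhds)
    from tendsto_Re[OF this] have "((\<lambda>s. Re (z 0 s)) \<longlongrightarrow> 1) (nhds 0)" by (simp add: z0)
    hence "eventually (\<lambda>s. Re (z 0 s) > 0) (nhds 0)" by (rule order_tendstoD) simp
    then obtain r3 where r3: "r3 > 0" "\<And>s. dist s 0 < r3 \<Longrightarrow> Re (z 0 s) > 0"
      unfolding eventually_nhds_metric by blast
    show thesis
    proof (rule that[of "min r1 (min r2 r3)"])
      show "e i holomorphic_on ball 0 (min r1 (min r2 r3))" if "i \<le> m" for i
        using that by (intro holomorphic_on_subset[OF r1(2)[rule_format]] subset_ball) auto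
      show "z i holomorphic_on ball 0 (min r1 (min r2 r3))" if "i \<le> m" for i
        using that by (intro holomorphic_on_subset[OF r2(2)[rule_format]] subset_ball) auto
    qed (use r1(1) r2(1) r3 in \<open>auto simp: dist_norm\<close>)
  qed
  define \<rho> where "\<rho> = r / 2 ^ q"
  have rho: "\<rho> > 0" "\<rho> \<le> r" using r(1) by (auto simp: \<rho>_def field_simps)

  define S where "S n s = 2 / fact (2 * n + 2) * (deriv ^^ (2 * n + 2)) (\<phi> s (g - n)) 1" for n s
  \<comment> \<open>The defect of the claimed identity, with the left-hand side counted as the
    summand n = 0.\<close>
  define \<Delta> where "\<Delta> s = (\<Sum>n\<le>g. S n s) - fps_nth (fps_log (Abs_fps (\<lambda>n. z n s))) g" for s
  have hol: "\<Delta> holomorphic_on ball 0 \<rho>"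
  proof -
    have "(\<lambda>s. fps_nth (fps_log (Abs_fps (\<lambda>n. z n s))) g) holomorphic_on ball 0 r"
      by (intro fps_log_nth_holomorphic r) (auto simp: m_def)
    hence "(\<lambda>s. fps_nth (fps_log (Abs_fps (\<lambda>n. z n s))) g) holomorphic_on ball 0 \<rho>"
      using rho by (elim holomorphic_on_subset) auto
    moreover have "S n holomorphic_on ball 0 \<rho>" for n
      unfolding S_def \<phi>_def \<rho>_def
      by (intro holomorphic_intros higher_deriv_scaled_holomorphic r) (auto simp: m_def)
    ultimately show ?thesis unfolding \<Delta>_def by (intro holomorphic_intros)
  qed

  define R where "R k t = complex_of_real (f k t) / (of_nat k)\<^sup>2 - (\<Sum>n\<le>m. e n (of_real t) * (1 / of_nat k) ^ (2 * n))" for k t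
  \<comment> \<open>The endpoints are chosen only to stay among positive times within the disc of
    radius \<rho>.\<close>
  have "\<exists>\<alpha> \<beta> C N. \<rho> / 4 \<le> \<alpha> \<and> \<alpha> < \<beta> \<and> \<beta> \<le> \<rho> / 2 \<and>
      (\<forall>k\<ge>N. \<forall>t\<in>{\<alpha>..\<beta>}. norm (R k t) \<le> C * (1 / real k) ^ (2 * m + 2))"
  proof (rule pointwise_bigo_imp_uniform_on_subinterval[where K = 1])
    show "continuous_on {\<rho> / 4..\<rho> / 2} (R k)" if k: "k \<ge> 1" for k
    proof -
      note Z = partition_function_pos_continuous[OF nu1 k orth]
      have "continuous_on {\<rho> / 4..\<rho> / 2} (partition_function \<nu> k)"
        by (rule continuous_on_subset[OF Z(2)]) (use rho in auto)
      moreover have "partition_function \<nu> k t / partition_function \<nu> k 0 \<noteq> 0"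
        if "t \<in> {\<rho> / 4..\<rho> / 2}" for t
        using Z(1)[of t] Z(1)[of 0] that rho by auto
      moreover have "continuous_on {\<rho> / 4..\<rho> / 2} (\<lambda>t. e n (of_real t))" if "n \<le> m" for n
        by (rule continuous_on_compose2[OF holomorphic_on_imp_continuous_on[OF r(2)[OF that]]])
           (use rho in \<open>auto intro!: continuous_intros\<close>)
      ultimately show ?thesis
        unfolding R_def f_def by (intro continuous_intros) (use Z(1)[of 0] k in auto)
    qed
    show "\<exists>C. eventually (\<lambda>k. norm (R k t) \<le> C * (1 / real k) ^ (2 * m + 2)) sequentially"
      if "t \<in> {\<rho> / 4..\<rho> / 2}" for t
    proof -
      have "(\<lambda>k. R k t) \<in> O(\<lambda>k. (1 / of_nat k) ^ (2 * m + 2))"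
        using has_asymp_expansion_normalized[OF e_expansion[of t], of m] that rho
        by (simp add: R_def f_def)
      then obtain c where "eventually (\<lambda>k. norm (R k t) \<le> c * norm ((1 / of_nat k :: complex) ^ (2 * m + 2))) sequentially"
        by (rule landau_o.bigE)
      thus ?thesis by (simp only: norm_power norm_divide norm_one norm_of_nat) blast
    qed
  qed (use rho in auto)
  then obtain \<alpha> \<beta> C N where ab: "\<rho> / 4 \<le> \<alpha>" "\<alpha> < \<beta>" "\<beta> \<le> \<rho> / 2"
    and unif: "\<And>k t. k \<ge> N \<Longrightarrow> t \<in> {\<alpha>..\<beta>} \<Longrightarrow> norm (R k t) \<le> C * (1 / real k) ^ (2 * m + 2)" by blast

  have zero: "\<Delta> (of_real s) = 0" if s: "- s \<in> {\<alpha><..<\<beta>}" for s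
  proof -
    have s0: "s \<le> 0" and sr: "complex_of_real s \<in> ball 0 r" using s ab rho by auto
    have diff: "(\<lambda>k. (\<Sum>h\<le>m. (1 / of_nat k) ^ (2 * h) * (\<phi> s h (1 + 1 / of_nat k) + \<phi> s h (1 - 1 / of_nat k) - 2 * \<phi> s h 1))
        - (1 / of_nat k)\<^sup>2 * of_real (ln (a s k))) \<in> O(\<lambda>k. (1 / of_nat k) ^ (2 * m + 2))"
      unfolding \<phi>_def
    proof (rule second_difference_of_uniform_expansion[where f = f and e = e, OF s unif[unfolded R_def]])
      show "f (k + 1) (- (s * (real (k + 1) / real k) ^ q)) +
          f (k - 1) (- (s * (real (k - 1) / real k) ^ q)) - 2 * f k (- s) = ln (a s k)" if "k \<ge> 2" for k
        unfolding f_def a_def q_def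
        by (rule partition_function_second_difference[OF nu1 that b_recurrence b_recurrence])
           (use s0 in \<open>auto simp: divide_nonpos_nonneg\<close>)
    qed
    \<comment> \<open>As a limit of real numbers z 0 is real at s, so together with the positive
      real part it is a positive real, as the expansion of the logarithm demands.\<close>
    have "Im (z 0 (of_real s)) = 0"
      using tendsto_Im[OF a_lim[OF s0]] LIMSEQ_unique[of "\<lambda>_. 0 :: real"] by (simp add: tendsto_const)
    hence zc: "z 0 (of_real s) = of_real (Re (z 0 (of_real s)))" by (simp add: complex_eq_iff)
    have "(\<Sum>n\<le>g. 2 / fact (2 * n + 2) * (deriv ^^ (2 * n + 2)) (\<phi> s (g - n)) 1) =
        fps_nth (fps_log (Abs_fps (\<lambda>n. z n (of_real s)))) g"
    proof (rule second_difference_expansion_coefficients[OF _ zc r(4)[OF sr] a_asymp[OF s0, of m] diff])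
      show "\<phi> s h analytic_on {1}" if "h \<le> m" for h
      proof -
        have "e h analytic_on ball 0 r" using r(2)[OF that] by (simp add: analytic_on_open)
        hence "e h analytic_on (\<lambda>w. - (w ^ q) * of_real s) ` {1}"
          using sr by (elim analytic_on_subset) auto
        hence "(e h \<circ> (\<lambda>w. - (w ^ q) * of_real s)) analytic_on {1}"
          by (intro analytic_on_compose analytic_intros)
        thus ?thesis unfolding \<phi>_def o_def by (intro analytic_intros) auto
      qed
    qed (simp add: m_def)
    thus ?thesis by (simp add: \<Delta>_def S_def)
  qed

  have \<Delta>0: "\<Delta> s = 0" if "s \<in> ball 0 \<rho>" for s
  proof (rule analytic_continuation[OF hol open_ball connected_ball _ _ _ _ that])
    define c where "c = - (\<alpha> + \<beta>) / 2"
    have c: "\<bar>c\<bar> < \<rho>" using ab rho by (simp add: c_def)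
    define U where "U = complex_of_real ` {- \<beta><..<- \<alpha>}"
    show "U \<subseteq> ball 0 \<rho>" using ab rho by (auto simp: U_def)
    show "complex_of_real c \<in> ball 0 \<rho>" using c by simp
    show "\<Delta> w = 0" if "w \<in> U" for w using that zero by (auto simp: U_def)
    show "complex_of_real c islimpt U"
      unfolding islimpt_approachable
    proof (intro allI impI)
      fix d :: real assume d: "d > 0"
      \<comment> \<open>Half of d keeps x close to the midpoint c; a quarter of the length keeps it
        inside the segment.\<close>
      define x where "x = c + min (d / 2) ((\<beta> - \<alpha>) / 4)"
      have x: "x \<in> {- \<beta><..<- \<alpha>}" "x \<noteq> c" "\<bar>x - c\<bar> < d"
        using d ab by (auto simp: x_def c_def min_def field_simps)
      have "dist (complex_of_real x) (complex_of_real c) < d"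
        unfolding dist_of_real using x(3) by (simp add: dist_real_def)
      thus "\<exists>x'\<in>U. x' \<noteq> complex_of_real c \<and> dist x' (complex_of_real c) < d"
        using x(1,2) unfolding U_def by (intro bexI[of _ "complex_of_real x"]) (auto simp only: of_real_eq_iff)
    qed
  qed

  have "eventually (\<lambda>s. s \<in> ball 0 \<rho>) (nhds (0 :: complex))"
    using rho by (intro eventually_nhds_in_open) auto
  thus "\<forall>\<^sub>F s in nhds (0 :: complex).
          (deriv ^^ 2) (\<lambda>w. w powi (2 - 2 * int g) * e g (- (w ^ (\<nu> - 1)) * s)) 1 =
          - (\<Sum>n=1..g. 2 / fact (2 * n + 2) *
               (deriv ^^ (2 * n + 2))
                 (\<lambda>w. w powi (2 - 2 * int (g - n)) * e (g - n) (- (w ^ (\<nu> - 1)) * s)) 1)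
          + fps_nth (fps_log (Abs_fps (\<lambda>n. z n s))) g"
  proof eventually_elim
    case (elim s)
    have "(\<Sum>n\<le>g. S n s) = S 0 s + (\<Sum>n=1..g. S n s)"
      by (simp add: atMost_atLeast0 sum.atLeast_Suc_atMost)
    moreover have "S 0 s = (deriv ^^ 2) (\<phi> s g) 1" by (simp add: S_def numeral_2_eq_2)
    ultimately have *: "(deriv ^^ 2) (\<phi> s g) 1 = - (\<Sum>n=1..g. S n s) + fps_nth (fps_log (Abs_fps (\<lambda>n. z n s))) g"
      using \<Delta>0[OF elim] by (simp add: \<Delta>_def algebra_simps)
    have "\<phi> s h = (\<lambda>w. w powi (2 - 2 * int h) * e h (- (w ^ (\<nu> - 1)) * s))" for h
      by (simp add: fun_eq_iff \<phi>_def q_def)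
    with * show ?case by (simp only: S_def)
  qed
qed

end
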